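(* For all $m,n\in\mathbb{N}$, the Hausdorff dimension of $\mathfrak{B}(m,n)$ equals $mn$.
   Context: Let $\mathbb{F}$ be the finite field with $k=p^r$ elements ($p$ prime, $r\ge 1$). Let $\mathcal{L}=\mathbb{F}((X^{-1}))$ be the field of formal Laurent series $\sum_{i=-n}^{\infty}a_{-i}X^{-i}$ ($a_i\in\mathbb{F}$), with absolute value $|x|=k^{n}$ if $x=\sum_{i=-n}^\infty a_{-i}X^{-i}$ with $a_n\neq 0$, and $|0|=0$. On $\mathcal{L}^h$ use the height $\|\mathbf{x}\|_\infty=\max_i|x_i|$ and the induced (ultrametric) metric; balls are balls for this metric. For $\mathbf{x}\in\mathcal{L}^h$ let $\langle\mathbf{x}\rangle=\min_{\mathbf{p}\in\mathbb{F}[X]^h}\|\mathbf{x}-\mathbf{p}\|_\infty$. Identify $m\times n$ matrices over $\mathcal{L}$ with $\mathcal{L}^{mn}$; $\mathbf{q}A$ is the usual vector–matrix product. Define $$\mathfrak{B}(m,n)=\{A\in\mathcal{L}^{mn}:\exists K>0\ \forall \mathbf{q}\in\mathbb{F}[X]^m\setminus\{0\}:\ \langle\mathbf{q}A\rangle^n>K/\|\mathbf{q}\|_\infty^m\}.$$ Hausdorff dimension on $\mathcal{L}^{mn}$ is defined as usual via covers by balls $B(\mathbf{c}_i,\rho_i)$ with $s$-length $\sum_i\rho_i^s$. *)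

theory Defs
  imports "HOL-Analysis.Analysis" "HOL-Computational_Algebra.Formal_Laurent_Series"
begin

text \<open>The field L = F((X^{-1})) is represented by the library type 'a fls of formal
Laurent series in the variable Y = X^{-1} (finitely many negative powers of Y =
finitely many positive powers of X). The coefficient of X^i is fls_nth x (-i).\<close>

definition lsabs :: "'a::{finite,field} fls \<Rightarrow> real" where
  "lsabs x = (if x = 0 then 0 else real CARD('a) powi (- fls_subdegree x))"

text \<open>Polynomials F[X]: no negative powers of X, i.e. no positive powers of Y.\<close>
definition is_poly :: "'a::{finite,field} fls \<Rightarrow> bool" where
  "is_poly x \<longleftrightarrow> (\<forall>i>0. fls_nth x i = 0)"

definition vnorm :: "('i::finite \<Rightarrow> 'a::{finite,field} fls) \<Rightarrow> real" where
  "vnorm x = Max (range (\<lambda>i. lsabs (x i)))"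

definition dist_poly :: "('i::finite \<Rightarrow> 'a::{finite,field} fls) \<Rightarrow> real" where
  "dist_poly x = Inf {vnorm (\<lambda>i. x i - p i) | p. \<forall>i. is_poly (p i)}"

definition vecmat :: "('m::finite \<Rightarrow> 'a::field) \<Rightarrow> ('m \<Rightarrow> 'n \<Rightarrow> 'a) \<Rightarrow> ('n \<Rightarrow> 'a)" where
  "vecmat q A = (\<lambda>j. \<Sum>i\<in>UNIV. q i * A i j)"

definition mdist :: "('m::finite \<Rightarrow> 'n::finite \<Rightarrow> 'a::{finite,field} fls) \<Rightarrow> ('m \<Rightarrow> 'n \<Rightarrow> 'a fls) \<Rightarrow> real" where
  "mdist A B = Max {lsabs (A i j - B i j) | i j. True}"

definition badly_approx :: "('m::finite \<Rightarrow> 'n::finite \<Rightarrow> 'a::{finite,field} fls) set" where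
  "badly_approx = {A. \<exists>K>0. \<forall>q::'m \<Rightarrow> 'a fls. (\<forall>i. is_poly (q i)) \<and> q \<noteq> (\<lambda>_. 0) \<longrightarrow>
       dist_poly (vecmat q A) ^ CARD('n) > K / vnorm q ^ CARD('m)}"

definition hausdorff_pre :: "('x \<Rightarrow> 'x \<Rightarrow> real) \<Rightarrow> real \<Rightarrow> real \<Rightarrow> 'x set \<Rightarrow> ennreal" where
  "hausdorff_pre d s \<delta> E = (INF (c, \<rho>) \<in> {(c :: nat \<Rightarrow> 'x, \<rho> :: nat \<Rightarrow> real).
        (\<forall>i. 0 < \<rho> i \<and> \<rho> i \<le> \<delta>) \<and> E \<subseteq> (\<Union>i. {y. d y (c i) \<le> \<rho> i})}.
      (\<Sum>i. ennreal (\<rho> i powr s)))"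

definition hausdorff_measure :: "('x \<Rightarrow> 'x \<Rightarrow> real) \<Rightarrow> real \<Rightarrow> 'x set \<Rightarrow> ennreal" where
  "hausdorff_measure d s E = (SUP \<delta> \<in> {0<..}. hausdorff_pre d s \<delta> E)"

definition hausdorff_dim :: "('x \<Rightarrow> 'x \<Rightarrow> real) \<Rightarrow> 'x set \<Rightarrow> ereal" where
  "hausdorff_dim d E = Inf {ereal s | s. 0 \<le> s \<and> hausdorff_measure d s E = 0}"

end

theory Submission
  imports Defs "HOL-Library.Function_Algebras"
begin

text \<open>
  Let k be the cardinality of the field and d = m + n. A matrix A is badly approximable as soon as,
  at all times t = TN, the lattice of vectors (q, qA - p), with the first m coordinates contracted
  by X^{nt} and the last n expanded by X^{mt}, contains no short nonzero vector. This condition at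
  time t only depends on A up to precision k^{-dt}.

  Suppose the lattice at time t has no short vector. Its points of height at most k^l form a finite
  group whose order is bounded trivially for small l, and equals the expected value for l beyond a
  constant: the groups of leading coefficients increase with l, and as long as they are proper they
  cost a factor 2 each time, which the known count at very large l permits only boundedly often.
  A short vector at time t + T comes from one of these points, and a given point becomes short
  only for a small proportion of the refinements of A. Summing, at most a quarter of the
  k^{mndT} refinements of A are lost when passing from t to t + T.

  So the badly approximable matrices contain a tree in which every node keeps at least half of its
  children. Given a cover by balls of too small total s-length, always moving to a child that holds
  the least s-length of centers yields a branch whose limit lies in no ball of the cover. This
  works for every s < mn once T is large.
\<close>

section \<open>Valuations and additive groups\<close>

text \<open>The ball condition |x| \<le> k^{-e} in terms of coefficients. With integer exponents in
  place of real absolute values, the ultrametric inequality holds coefficient by coefficient and 0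
  needs no special case.\<close>

definition val_ge :: "'a::zero fls \<Rightarrow> int \<Rightarrow> bool" where
  "val_ge x e \<longleftrightarrow> (\<forall>l<e. fls_nth x l = 0)"

lemma val_ge_iff_subdegree: "val_ge x e \<longleftrightarrow> x = 0 \<or> e \<le> fls_subdegree x"
proof
  assume "val_ge x e"
  then show "x = 0 \<or> e \<le> fls_subdegree x"
    unfolding val_ge_def using nth_fls_subdegree_nonzero[of x] by (meson not_le)
qed (auto simp: val_ge_def)

lemma val_ge_0 [simp]: "val_ge 0 e"
  by (simp add: val_ge_def)

lemma val_ge_mono: "val_ge x e \<Longrightarrow> e' \<le> e \<Longrightarrow> val_ge x e'"
  by (simp add: val_ge_def)

lemma val_ge_add: "val_ge x e \<Longrightarrow> val_ge y e \<Longrightarrow> val_ge (x + y) e"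
  for x y :: "'a::comm_monoid_add fls"
  by (simp add: val_ge_def)

lemma val_ge_diff: "val_ge x e \<Longrightarrow> val_ge y e \<Longrightarrow> val_ge (x - y) e"
  for x y :: "'a::ab_group_add fls"
  by (simp add: val_ge_def)

lemma val_ge_minus_commute: "val_ge (x - y) e \<longleftrightarrow> val_ge (y - x) e"
  for x y :: "'a::ab_group_add fls"
  by (auto simp: val_ge_def)

lemma val_ge_sum: "(\<And>i. i \<in> I \<Longrightarrow> val_ge (f i) e) \<Longrightarrow> val_ge (\<Sum>i\<in>I. f i) e"
  for f :: "'b \<Rightarrow> 'a::comm_monoid_add fls"
  by (induction I rule: infinite_finite_induct) (auto intro: val_ge_add)

lemma val_ge_mult: "val_ge x a \<Longrightarrow> val_ge y b \<Longrightarrow> val_ge (x * y) (a + b)"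
  for x y :: "'a::idom fls"
  by (cases "x = 0 \<or> y = 0") (auto simp: val_ge_iff_subdegree)

text \<open>Valuations add in a domain. A nonzero coefficient at \<open>a\<close> bounds the
  valuation of \<open>x\<close> from above by \<open>a\<close>, so \<open>y\<close> has to supply
  the remaining \<open>b\<close>.\<close>

lemma val_ge_mult_cancel:
  fixes x y :: "'a::idom fls"
  assumes "val_ge (x * y) (a + b)" and "fls_nth x a \<noteq> 0"
  shows "val_ge y b"
proof (cases "y = 0")
  case False
  have "x \<noteq> 0" using assms(2) by auto
  moreover have "fls_subdegree x \<le> a"
    using assms(2) fls_subdegree_leI by blast
  ultimately show ?thesis
    using assms(1) False by (auto simp: val_ge_iff_subdegree)
qed simp

lemma card_field_ge_2: "2 \<le> CARD('a::{finite,field})"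
proof -
  have "card {0, 1 :: 'a} \<le> CARD('a)" by (intro card_mono) auto
  then show ?thesis by simp
qed

lemma lsabs_le_iff:
  "lsabs (x :: 'a::{finite,field} fls) \<le> real CARD('a) powi (- e) \<longleftrightarrow> val_ge x e"
proof -
  have k: "1 < real CARD('a)" using card_field_ge_2[where 'a='a] by simp
  show ?thesis
  proof (cases "x = 0")
    case False
    have "real CARD('a) powi (- fls_subdegree x) \<le> real CARD('a) powi (- e) \<longleftrightarrow> e \<le> fls_subdegree x"
      using power_int_increasing[of "- fls_subdegree x" "- e" "real CARD('a)"]
        power_int_strict_increasing[of "- e" "- fls_subdegree x" "real CARD('a)"] k
      by (smt (verit))
    then show ?thesis using False by (simp add: lsabs_def val_ge_iff_subdegree)
  qed (use k in \<open>simp add: lsabs_def\<close>)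
qed

lemma vnorm_le_iff: "vnorm x \<le> r \<longleftrightarrow> (\<forall>i. lsabs (x i) \<le> r)"
  unfolding vnorm_def by (subst Max_le_iff) auto

lemma mdist_le_iff: "mdist A B \<le> r \<longleftrightarrow> (\<forall>i j. lsabs (A i j - B i j) \<le> r)"
proof -
  have "{lsabs (A i j - B i j) | i j. True} = (\<lambda>(i, j). lsabs (A i j - B i j)) ` UNIV"
    by auto
  then show ?thesis unfolding mdist_def by (simp only:) (subst Max_le_iff; auto)
qed

section \<open>Counting in additive groups\<close>

lemma additive_closed_add:
  fixes G :: "'b::ab_group_add set"
  assumes sub: "\<And>x y. x \<in> G \<Longrightarrow> y \<in> G \<Longrightarrow> x - y \<in> G" and "x \<in> G" "y \<in> G"
  shows "x + y \<in> G"
  using sub[OF assms(2) sub[OF sub[OF assms(3,3)] assms(3)]] by simp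

text \<open>The first isomorphism theorem as a bijection, for sets closed under subtraction:
  \<open>inv_into\<close> picks one representative in each fibre of \<open>f\<close>, and an element
  differs from its representative by an element of the kernel.\<close>

lemma bij_betw_kernel_image:
  fixes f :: "'b::ab_group_add \<Rightarrow> 'c::ab_group_add"
  assumes sub: "\<And>x y. x \<in> G \<Longrightarrow> y \<in> G \<Longrightarrow> x - y \<in> G"
    and f: "\<And>x y. f (x - y) = f x - f y"
  shows "bij_betw (\<lambda>x. (x - inv_into G f (f x), f x)) G ({x \<in> G. f x = 0} \<times> f ` G)"
proof -
  have g: "inv_into G f (f x) \<in> G" "f (inv_into G f (f x)) = f x" if "x \<in> G" for x
    using that by (auto intro: inv_into_into f_inv_into_f)
  have fp: "f (x + y) = f x + f y" for x y
    using f[of "x + y" y] by simp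
  show ?thesis
  proof (rule bij_betwI')
    fix x y assume "x \<in> G" "y \<in> G"
    then show "((x - inv_into G f (f x), f x) = (y - inv_into G f (f y), f y)) = (x = y)"
      by auto
  next
    fix x assume "x \<in> G"
    then show "(x - inv_into G f (f x), f x) \<in> {x \<in> G. f x = 0} \<times> f ` G"
      using g f sub by auto
  next
    fix p assume "p \<in> {x \<in> G. f x = 0} \<times> f ` G"
    then obtain u y where p: "p = (u, f y)" "u \<in> G" "f u = 0" "y \<in> G" by auto
    let ?x = "u + inv_into G f (f y)"
    have "?x \<in> G" using additive_closed_add[of G, OF sub] p g by blast
    moreover have "f ?x = f y" using p g by (simp add: fp)
    ultimately show "\<exists>x\<in>G. p = (x - inv_into G f (f x), f x)"
      using p by (intro bexI[of _ ?x]) auto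
  qed
qed

text \<open>The translate of \<open>S\<close> by a point outside \<open>S\<close> is disjoint from
  \<open>S\<close> and has the same size.\<close>

lemma card_proper_additive_subset:
  fixes S :: "'b::{finite,ab_group_add} set"
  assumes sub: "\<And>x y. x \<in> S \<Longrightarrow> y \<in> S \<Longrightarrow> x - y \<in> S" and "S \<noteq> UNIV"
  shows "2 * card S \<le> CARD('b)"
proof -
  obtain x where x: "x \<notin> S" using assms(2) by auto
  have "S \<inter> (+) x ` S = {}"
    using x sub by (auto simp: disjoint_iff) (metis add_diff_cancel_right')
  then have "card (S \<union> (+) x ` S) = 2 * card S"
    by (subst card_Un_disjoint) (auto simp: card_image)
  then show ?thesis by (metis card_mono finite top_greatest)
qed

section \<open>Lattice points in boxes\<close>

text \<open>These are the points of height at most k^l once coordinate \<open>i\<close> has been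
  multiplied by X^{w i}; \<open>lead\<close> below then reads off the coefficients of X^l of the
  scaled coordinates.\<close>

definition lat_ball :: "('i \<Rightarrow> 'a::zero fls) set \<Rightarrow> ('i \<Rightarrow> int) \<Rightarrow> nat \<Rightarrow> ('i \<Rightarrow> 'a fls) set" where
  "lat_ball L w l = {v \<in> L. \<forall>i. val_ge (v i) (w i - int l)}"

definition lead :: "('i \<Rightarrow> int) \<Rightarrow> nat \<Rightarrow> ('i \<Rightarrow> 'a::zero fls) \<Rightarrow> 'i \<Rightarrow> 'a" where
  "lead w l v = (\<lambda>i. fls_nth (v i) (w i - int l))"

lemma lead_diff: "lead w l (u - v) = lead w l u - lead w l v"
  for u v :: "'i \<Rightarrow> 'a::ab_group_add fls"
  by (simp add: lead_def fun_eq_iff)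

text \<open>An additive group stable under multiplication by X: \<open>fls_shift 1\<close>
  multiplies by Y^{-1} = X.\<close>

locale poly_lattice =
  fixes L :: "('i::finite \<Rightarrow> 'a::{finite,field} fls) set"
  assumes diff: "u \<in> L \<Longrightarrow> v \<in> L \<Longrightarrow> u - v \<in> L"
    and shift: "v \<in> L \<Longrightarrow> (\<lambda>i. fls_shift 1 (v i)) \<in> L"
begin

lemma lat_ball_diff: "u \<in> lat_ball L w l \<Longrightarrow> v \<in> lat_ball L w l \<Longrightarrow> u - v \<in> lat_ball L w l"
  by (auto simp: lat_ball_def intro: diff val_ge_diff)

lemma lat_ball_kernel: "{v \<in> lat_ball L w (Suc l). lead w (Suc l) v = 0} = lat_ball L w l"
proof -
  have "val_ge x (e - int l) \<longleftrightarrow> val_ge x (e - int (Suc l)) \<and> fls_nth x (e - int (Suc l)) = 0"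
    for x :: "'a fls" and e
    unfolding val_ge_def
  proof safe
    fix j assume "\<forall>j<e - int (Suc l). fls_nth x j = 0" "fls_nth x (e - int (Suc l)) = 0"
      and "j < e - int l"
    then show "fls_nth x j = 0"
      by (cases "j = e - int (Suc l)") auto
  qed auto
  then show ?thesis by (auto simp: lat_ball_def lead_def fun_eq_iff)
qed

text \<open>Multiplication by X maps level \<open>l\<close> into level \<open>Suc l\<close> and
  carries the leading coefficients along unchanged.\<close>

lemma lead_image_mono: "lead w l ` lat_ball L w l \<subseteq> lead w (Suc l) ` lat_ball L w (Suc l)"
proof
  fix y assume "y \<in> lead w l ` lat_ball L w l"
  then obtain v where v: "v \<in> lat_ball L w l" "y = lead w l v" by auto
  let ?u = "\<lambda>i. fls_shift 1 (v i)"
  have "?u \<in> lat_ball L w (Suc l)"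
    using v(1) shift by (auto simp: lat_ball_def val_ge_def)
  moreover have "y = lead w (Suc l) ?u"
    by (auto simp: v lead_def fun_eq_iff algebra_simps)
  ultimately show "y \<in> lead w (Suc l) ` lat_ball L w (Suc l)" by blast
qed

text \<open>The kernel of \<open>lead\<close> on the ball of level \<open>Suc l\<close> is the ball
  of level \<open>l\<close>, so the group of leading coefficients measures the growth from one level
  to the next.\<close>

lemma finite_card_lat_ball_Suc:
  assumes "finite (lat_ball L w l)"
  shows "finite (lat_ball L w (Suc l))"
    and "card (lat_ball L w (Suc l)) = card (lat_ball L w l) * card (lead w (Suc l) ` lat_ball L w (Suc l))"
proof -
  have b: "bij_betw (\<lambda>x. (x - inv_into (lat_ball L w (Suc l)) (lead w (Suc l)) (lead w (Suc l) x), lead w (Suc l) x))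
    (lat_ball L w (Suc l)) (lat_ball L w l \<times> lead w (Suc l) ` lat_ball L w (Suc l))"
    using bij_betw_kernel_image[of "lat_ball L w (Suc l)" "lead w (Suc l)"]
    by (simp add: lat_ball_diff lead_diff lat_ball_kernel)
  have "finite (lead w (Suc l) ` lat_ball L w (Suc l))"
    by (rule finite_subset[OF subset_UNIV]) simp
  then show "finite (lat_ball L w (Suc l))"
    unfolding bij_betw_finite[OF b] using assms by (rule finite_cartesian_product[rotated])
  show "card (lat_ball L w (Suc l)) = card (lat_ball L w l) * card (lead w (Suc l) ` lat_ball L w (Suc l))"
    using bij_betw_same_card[OF b] by (simp add: card_cartesian_product)
qed

context
  fixes w :: "'i \<Rightarrow> int"
  assumes V0: "lat_ball L w 0 = {0}"
begin

lemma finite_lat_ball: "finite (lat_ball L w l)"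
  by (induction l) (auto simp: V0 intro: finite_card_lat_ball_Suc(1))

lemma card_lead_le: "card (lead w l ` lat_ball L w l) \<le> CARD('a) ^ CARD('i)"
proof -
  have "card (lead w l ` lat_ball L w l) \<le> CARD('i \<Rightarrow> 'a)"
    by (rule card_mono) auto
  then show ?thesis by (simp add: card_fun)
qed

lemma card_lat_ball_Suc:
  "card (lat_ball L w (Suc l)) = card (lat_ball L w l) * card (lead w (Suc l) ` lat_ball L w (Suc l))"
  by (rule finite_card_lat_ball_Suc(2)[OF finite_lat_ball])

lemma card_lat_ball_add_le:
  "card (lat_ball L w (l + j)) \<le> card (lat_ball L w l) * (CARD('a) ^ CARD('i)) ^ j"
proof (induction j)
  case (Suc j)
  have "card (lat_ball L w (l + Suc j)) \<le> card (lat_ball L w (l + j)) * CARD('a) ^ CARD('i)"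
    using card_lat_ball_Suc[of "l + j"] card_lead_le by simp
  also have "\<dots> \<le> card (lat_ball L w l) * (CARD('a) ^ CARD('i)) ^ j * CARD('a) ^ CARD('i)"
    using Suc by simp
  finally show ?case by (simp add: mult_ac)
qed simp

lemma card_lat_ball_le: "card (lat_ball L w l) \<le> CARD('a) ^ (CARD('i) * l)"
  using card_lat_ball_add_le[of 0 l] by (simp add: V0 power_mult)

lemma lead_image_mono': "l \<le> l' \<Longrightarrow> lead w l ` lat_ball L w l \<subseteq> lead w l' ` lat_ball L w l'"
  by (rule lift_Suc_mono_le[of "\<lambda>l. lead w l ` lat_ball L w l"]) (rule lead_image_mono)

text \<open>A proper subgroup of leading coefficients costs a factor two, and by monotonicity it does so
  at all smaller levels as well.\<close>
lemma card_lat_ball_deficient: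
  assumes "lead w l ` lat_ball L w l \<noteq> UNIV"
  shows "2 ^ l * card (lat_ball L w l) \<le> CARD('a) ^ (CARD('i) * l)"
proof -
  have half: "2 * card (lead w j ` lat_ball L w j) \<le> CARD('a) ^ CARD('i)" if "j \<le> l" for j
  proof -
    have "2 * card (lead w j ` lat_ball L w j) \<le> CARD('i \<Rightarrow> 'a)"
    proof (rule card_proper_additive_subset)
      show "x - y \<in> lead w j ` lat_ball L w j"
        if "x \<in> lead w j ` lat_ball L w j" "y \<in> lead w j ` lat_ball L w j" for x y
        using that lat_ball_diff by (auto simp: lead_diff[symmetric])
      show "lead w j ` lat_ball L w j \<noteq> UNIV"
        using lead_image_mono'[OF that] assms by auto
    qed
    then show ?thesis by (simp add: card_fun)
  qed
  have "2 ^ j * card (lat_ball L w j) \<le> CARD('a) ^ (CARD('i) * j)" if "j \<le> l" for j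
    using that
  proof (induction j)
    case (Suc j)
    have "2 ^ Suc j * card (lat_ball L w (Suc j)) =
        (2 ^ j * card (lat_ball L w j)) * (2 * card (lead w (Suc j) ` lat_ball L w (Suc j)))"
      by (simp add: card_lat_ball_Suc)
    also have "\<dots> \<le> CARD('a) ^ (CARD('i) * j) * CARD('a) ^ CARD('i)"
      using Suc half[of "Suc j"] by (intro mult_mono) auto
    finally show ?case by (simp add: power_add mult_ac)
  qed (simp add: V0)
  then show ?thesis by simp
qed

text \<open>Write d for the number of coordinates. A deficient level j \<ge> l would make the count
  there too small by a factor 2^j. As no later level gains more than k^d, the known count far out
  would force 2^j \<le> k^{d a} \<le> j. Hence from \<open>l\<close> on every level gains exactly
  k^d, and the count at \<open>l\<close> can be read back from a large level.\<close>

lemma card_lat_ball_eventually: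
  assumes large: "\<And>l. l \<ge> l1 \<Longrightarrow> card (lat_ball L w l) = CARD('a) ^ (CARD('i) * (l - a))"
    and l: "l \<ge> CARD('a) ^ (CARD('i) * a)"
  shows "card (lat_ball L w l) = CARD('a) ^ (CARD('i) * (l - a))"
proof -
  let ?k = "CARD('a)" let ?d = "CARD('i)"
  have k: "2 \<le> ?k" by (rule card_field_ge_2)
  \<comment> \<open>This makes the natural subtraction \<open>l - a\<close> a true
    difference.\<close>
  have "a \<le> l"
  proof -
    have "a < 2 ^ a" by simp
    also have "(2::nat) ^ a \<le> ?k ^ a" using k by (simp add: power_mono)
    also have "\<dots> \<le> ?k ^ (?d * a)" using k by (intro power_increasing) auto
    finally show ?thesis using l by simp
  qed
  have full: "lead w j ` lat_ball L w j = UNIV" if "l \<le> j" for j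
  proof (rule ccontr)
    assume "lead w j ` lat_ball L w j \<noteq> UNIV"
    from card_lat_ball_deficient[OF this]
    have 1: "2 ^ j * card (lat_ball L w j) \<le> ?k ^ (?d * j)" .
    \<comment> \<open>Going up by \<open>l1\<close> reaches the range of \<open>large\<close>; the
      extra \<open>a\<close> keeps \<open>j + e - a\<close> from truncating.\<close>
    define e where "e = l1 + a"
    have "?k ^ (?d * (j + e - a)) = card (lat_ball L w (j + e))"
      by (rule large[symmetric]) (simp add: e_def)
    also have "\<dots> \<le> card (lat_ball L w j) * ?k ^ (?d * e)"
      using card_lat_ball_add_le[of j e] by (simp add: power_mult)
    finally have "2 ^ j * ?k ^ (?d * (j + e - a)) \<le> (2 ^ j * card (lat_ball L w j)) * ?k ^ (?d * e)"
      by simp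
    also have "\<dots> \<le> ?k ^ (?d * j) * ?k ^ (?d * e)"
      using 1 by simp
    also have "\<dots> = ?k ^ (?d * a) * ?k ^ (?d * (j + e - a))"
      by (simp add: e_def add_ac flip: power_add distrib_left)
    finally have "2 ^ j \<le> ?k ^ (?d * a)" using k by simp
    also have "\<dots> \<le> j" using l that by simp
    finally show False using less_exp[of j] by simp
  qed
  have grow: "card (lat_ball L w (l + j)) = card (lat_ball L w l) * ?k ^ (?d * j)" for j
  proof (induction j)
    case (Suc j)
    then show ?case
      using card_lat_ball_Suc[of "l + j"] full[of "Suc (l + j)"]
      by (simp add: card_fun power_add mult_ac)
  qed simp
  have "card (lat_ball L w l) * ?k ^ (?d * l1) = ?k ^ (?d * (l + l1 - a))"
    using grow[of l1] large[of "l + l1"] by simp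
  also have "l + l1 - a = (l - a) + l1" using \<open>a \<le> l\<close> by simp
  also have "?k ^ (?d * ((l - a) + l1)) = ?k ^ (?d * (l - a)) * ?k ^ (?d * l1)"
    by (simp only: power_add distrib_left)
  finally show ?thesis using k by simp
qed

end

end

section \<open>The lattice of a system of linear forms\<close>

text \<open>The lattice of vectors (q, qA - p) with q and p polynomial; p is left implicit as the
  difference of qA and the last coordinates.\<close>

definition lin_lattice :: "('m::finite \<Rightarrow> 'n::finite \<Rightarrow> 'a::{finite,field} fls) \<Rightarrow> ('m + 'n \<Rightarrow> 'a fls) set" where
  "lin_lattice A = {v. (\<forall>i. is_poly (v (Inl i))) \<and> (\<forall>j. is_poly (vecmat (v \<circ> Inl) A j - v (Inr j)))}"

lemma vecmat_diff_left: "vecmat (q - q') A j = vecmat q A j - vecmat q' A j"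
  by (simp add: vecmat_def left_diff_distrib sum_subtractf)

lemma vecmat_diff_right: "vecmat q (A - B) j = vecmat q A j - vecmat q B j"
  by (simp add: vecmat_def right_diff_distrib sum_subtractf)

lemma vecmat_0_left [simp]: "vecmat 0 A j = 0"
  by (simp add: vecmat_def)

lemma val_ge_vecmat:
  fixes A :: "'m::finite \<Rightarrow> 'n \<Rightarrow> 'a::field fls"
  assumes "\<And>i. val_ge (q i) a" and "\<And>i. val_ge (A i j) b"
  shows "val_ge (vecmat q A j) (a + b)"
  unfolding vecmat_def using assms by (auto intro!: val_ge_sum val_ge_mult)

lemma is_poly_diff: "is_poly x \<Longrightarrow> is_poly y \<Longrightarrow> is_poly (x - y)"
  by (simp add: is_poly_def)

lemma is_poly_val_ge_imp_0: "is_poly x \<Longrightarrow> val_ge x 1 \<Longrightarrow> x = 0"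
proof (rule fls_eqI)
  fix z assume "is_poly x" "val_ge x 1"
  then show "fls_nth x z = fls_nth 0 z"
    by (cases "z > 0") (simp_all add: is_poly_def val_ge_def)
qed

lemma poly_lattice_lin_lattice: "poly_lattice (lin_lattice A)"
proof
  fix u v assume uv: "u \<in> lin_lattice A" "v \<in> lin_lattice A"
  have "vecmat ((u - v) \<circ> Inl) A j - (u - v) (Inr j)
      = (vecmat (u \<circ> Inl) A j - u (Inr j)) - (vecmat (v \<circ> Inl) A j - v (Inr j))" for j
    using vecmat_diff_left[of "u \<circ> Inl" "v \<circ> Inl" A j] by (simp add: fun_diff_def o_def)
  then show "u - v \<in> lin_lattice A"
    using uv unfolding lin_lattice_def mem_Collect_eq by (metis is_poly_diff minus_apply)
next
  fix v assume v: "v \<in> lin_lattice A"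
  have poly_shift: "is_poly x \<Longrightarrow> is_poly (fls_shift 1 x)" for x :: "'c::{finite,field} fls"
    by (simp add: is_poly_def)
  have "vecmat ((\<lambda>i. fls_shift 1 (v i)) \<circ> Inl) A j - fls_shift 1 (v (Inr j))
      = fls_shift 1 (vecmat (v \<circ> Inl) A j - v (Inr j))" for j
    by (simp add: vecmat_def sum_distrib_left mult.assoc right_diff_distrib
        flip: fls_X_inv_times_conv_shift(1))
  then show "(\<lambda>i. fls_shift 1 (v i)) \<in> lin_lattice A"
    using v unfolding lin_lattice_def mem_Collect_eq by (metis poly_shift)
qed

text \<open>The offset 3 makes vectors of height at most k^{-3} count as short; any larger constant would
  serve as well.\<close>
definition weight :: "nat \<Rightarrow> 'm::finite + 'n::finite \<Rightarrow> int" where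
  "weight t = case_sum (\<lambda>_. 3 - int CARD('n) * int t) (\<lambda>_. 3 + int CARD('m) * int t)"

lemma weight_simps [simp]:
  "weight t (Inl i :: 'm::finite + 'n::finite) = 3 - int CARD('n) * int t"
  "weight t (Inr j :: 'm::finite + 'n::finite) = 3 + int CARD('m) * int t"
  by (simp_all add: weight_def)

lemma nth_Abs_fls_ge: "(\<And>z. z < e \<Longrightarrow> f z = 0) \<Longrightarrow> fls_nth (Abs_fls f) z = f z"
  using nth_Abs_fls_lower_bound[of e f] by simp

text \<open>Once \<open>l\<close> is at least every weight, the coefficients of nonnegative powers
  of X can be chosen freely within the box and determine the vector: q has no others, and the
  fractional part of the last coordinates is that of qA.\<close>

lemma card_lin_lattice_ball_large:
  fixes A :: "'m::finite \<Rightarrow> 'n::finite \<Rightarrow> 'a::{finite,field} fls"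
  assumes l: "l \<ge> 3 + CARD('m) * t"
  shows "card (lat_ball (lin_lattice A) (weight t) l) = CARD('a) ^ (CARD('m + 'n) * (l - 2))"
proof -
  define w :: "'m + 'n \<Rightarrow> int" where "w = weight t"
  \<comment> \<open>The positions from \<open>w i - int l\<close> up to and including 0, hence the
    1.\<close>
  define h where "h = (\<lambda>i. nat (1 + int l - w i))"
  let ?S = "Sigma UNIV (\<lambda>i :: 'm + 'n. {..<h i})"
  let ?V = "lat_ball (lin_lattice A) w l"
  have wl: "w i \<le> int l" for i
  proof -
    have "int (3 + CARD('m) * t) \<le> int l" using l by (simp only: of_nat_le_iff)
    moreover have "0 \<le> int CARD('n) * int t" "0 \<le> int CARD('m) * int t" by simp_all
    moreover have "w i = 3 - int CARD('n) * int t \<or> w i = 3 + int CARD('m) * int t"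
      by (cases i) (simp_all add: w_def)
    ultimately show ?thesis unfolding of_nat_add of_nat_mult by linarith
  qed
  have bij: "bij_betw (\<lambda>v. restrict (\<lambda>(i, e). fls_nth (v i) (- int e)) ?S) ?V (PiE ?S (\<lambda>_. UNIV))"
  proof (rule bij_betwI')
    fix u v assume uv: "u \<in> ?V" "v \<in> ?V"
    have "u = v" if eq: "restrict (\<lambda>(i, e). fls_nth (u i) (- int e)) ?S = restrict (\<lambda>(i, e). fls_nth (v i) (- int e)) ?S"
    proof -
      have np: "fls_nth (u i) z = fls_nth (v i) z" if "z \<le> 0" for i z
      proof (cases "nat (- z) < h i")
        case True
        then show ?thesis using fun_cong[OF eq, of "(i, nat (- z))"] that by simp
      next
        case False
        then have "z < w i - int l" using that wl[of i] by (simp add: h_def)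
        then show ?thesis using uv by (simp add: lat_ball_def val_ge_def)
      qed
      have l: "u (Inl i) = v (Inl i)" for i
      proof (rule fls_eqI)
        fix z show "fls_nth (u (Inl i)) z = fls_nth (v (Inl i)) z"
          using np[of z] uv by (cases "z \<le> 0") (auto simp: lat_ball_def lin_lattice_def is_poly_def)
      qed
      then have q: "u \<circ> Inl = v \<circ> Inl" by auto
      have r: "u (Inr j) = v (Inr j)" for j
      proof (rule fls_eqI)
        fix z show "fls_nth (u (Inr j)) z = fls_nth (v (Inr j)) z"
          using np[of z] uv q by (cases "z \<le> 0") (auto simp: lat_ball_def lin_lattice_def is_poly_def)
      qed
      show "u = v"
      proof
        fix i show "u i = v i" using l r by (cases i) auto
      qed
    qed
    then show "(restrict (\<lambda>(i, e). fls_nth (u i) (- int e)) ?S = restrict (\<lambda>(i, e). fls_nth (v i) (- int e)) ?S) = (u = v)"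
      by blast
  next
    fix b :: "('m + 'n) \<times> nat \<Rightarrow> 'a" assume b: "b \<in> PiE ?S (\<lambda>_. UNIV)"
    define c where "c = (\<lambda>i z. if nat (- z) < h i then b (i, nat (- z)) else 0)"
    have c0: "c i z = 0" if "z < w i - int l" for i z
      using that by (simp add: c_def h_def)
    define q where "q = (\<lambda>i. Abs_fls (\<lambda>z. if z \<le> 0 then c (Inl i) z else 0))"
    \<comment> \<open>Nonpositive positions take the prescribed digits; positive ones copy qA, so
      that qA minus the new vector is polynomial.\<close>
    define x where "x = (\<lambda>j. Abs_fls (\<lambda>z. if z \<le> 0 then c (Inr j) z else fls_nth (vecmat q A j) z))"
    have q: "fls_nth (q i) z = (if z \<le> 0 then c (Inl i) z else 0)" for i z
      unfolding q_def by (rule nth_Abs_fls_ge[of "w (Inl i) - int l"]) (use c0 in auto)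
    have x: "fls_nth (x j) z = (if z \<le> 0 then c (Inr j) z else fls_nth (vecmat q A j) z)" for j z
      unfolding x_def by (rule nth_Abs_fls_ge[of "w (Inr j) - int l"]) (use c0 wl[of "Inr j"] in auto)
    let ?v = "case_sum q x"
    have "?v \<in> lin_lattice A"
      by (simp add: lin_lattice_def is_poly_def q x o_def)
    moreover have "val_ge (?v i) (w i - int l)" for i
      using wl[of i] by (cases i) (auto simp: val_ge_def q x c0)
    ultimately have "?v \<in> ?V" by (simp add: lat_ball_def)
    moreover have "b = restrict (\<lambda>(i, e). fls_nth (?v i) (- int e)) ?S"
    proof (rule ext, clarify)
      fix i e show "b (i, e) = restrict (\<lambda>(i, e). fls_nth (?v i) (- int e)) ?S (i, e)"
        using b by (cases i) (auto simp: q x c_def PiE_def extensional_def)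
    qed
    ultimately show "\<exists>v\<in>?V. b = restrict (\<lambda>(i, e). fls_nth (v i) (- int e)) ?S" by blast
  qed auto
  have "(\<Sum>i\<in>UNIV. h i) = CARD('m + 'n) * (l - 2)"
  proof -
    have "int (\<Sum>i\<in>UNIV. h i) = (\<Sum>i\<in>UNIV. 1 + int l - w i)"
      unfolding of_nat_sum by (rule sum.cong) (use wl in \<open>auto simp: h_def intro: add_increasing\<close>)
    also have "\<dots> = (\<Sum>i\<in>UNIV. 1 + int l - w (Inl i)) + (\<Sum>j\<in>UNIV. 1 + int l - w (Inr j))"
      by (simp only: UNIV_Plus_UNIV[symmetric] sum.Plus[OF finite finite] o_def)
    \<comment> \<open>The contributions mnt of the two kinds of coordinates cancel, so the weights
      have average 3 and the free positions have average 1 + l - 3.\<close>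
    also have "\<dots> = int CARD('m + 'n) * (int l - 2)"
      by (simp add: w_def algebra_simps)
    also have "\<dots> = int (CARD('m + 'n) * (l - 2))"
      using l by (simp add: of_nat_diff)
    finally show ?thesis by linarith
  qed
  then have "card (PiE ?S (\<lambda>_. UNIV :: 'a set)) = CARD('a) ^ (CARD('m + 'n) * (l - 2))"
    by (simp add: card_PiE)
  then show ?thesis using bij_betw_same_card[OF bij] by (simp add: w_def)
qed

section \<open>Times without short vectors and their stability under change of the matrix\<close>

definition good :: "('m::finite \<Rightarrow> 'n::finite \<Rightarrow> 'a::{finite,field} fls) \<Rightarrow> nat \<Rightarrow> bool" where
  "good A t \<longleftrightarrow> lat_ball (lin_lattice A) (weight t) 0 = {0}"

lemma zero_in_lat_ball: "0 \<in> lat_ball (lin_lattice A) w l"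
  by (simp add: lat_ball_def lin_lattice_def is_poly_def o_def vecmat_def)

lemma good_iff: "good A t \<longleftrightarrow> (\<forall>v \<in> lat_ball (lin_lattice A) (weight t) 0. v = 0)"
  using zero_in_lat_ball unfolding good_def by blast

text \<open>With q = 0 the last coordinates are themselves polynomials, and a polynomial of absolute
  value below 1 vanishes.\<close>

lemma lin_lattice_ball_eq_0:
  fixes A :: "'m::finite \<Rightarrow> 'n::finite \<Rightarrow> 'a::{finite,field} fls"
  assumes v: "v \<in> lat_ball (lin_lattice A) (weight t) 0" and "v \<circ> Inl = 0"
  shows "v = 0"
proof
  fix i show "v i = 0 i"
  proof (cases i)
    case (Inl a)
    then show ?thesis using fun_cong[OF assms(2), of a] by simp
  next
    case (Inr j)
    have "is_poly (0 - v (Inr j))" "val_ge (0 - v (Inr j)) (3 + int CARD('m) * int t)"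
      using v assms(2) by (auto simp: lat_ball_def lin_lattice_def val_ge_def)
    then have "0 - v (Inr j) = 0"
      by (intro is_poly_val_ge_imp_0) (auto elim: val_ge_mono)
    then show ?thesis using Inr by simp
  qed
qed

text \<open>The shear (q, y) to (q, y + qB). For B = A - A' it carries the lattice of A' into the
  lattice of A.\<close>

definition perturb :: "('m::finite \<Rightarrow> 'n::finite \<Rightarrow> 'a::{finite,field} fls) \<Rightarrow> ('m + 'n \<Rightarrow> 'a fls) \<Rightarrow> 'm + 'n \<Rightarrow> 'a fls" where
  "perturb B v = case_sum (v \<circ> Inl) (\<lambda>j. v (Inr j) + vecmat (v \<circ> Inl) B j)"

lemma perturb_simps [simp]:
  "perturb B v (Inl i) = v (Inl i)"
  "perturb B v (Inr j) = v (Inr j) + vecmat (v \<circ> Inl) B j"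
  "perturb B v \<circ> Inl = v \<circ> Inl"
  by (auto simp: perturb_def)

lemma perturb_eq_0D: "perturb B v = 0 \<Longrightarrow> v \<circ> Inl = 0"
proof
  fix i assume "perturb B v = 0"
  then show "(v \<circ> Inl) i = 0 i" using perturb_simps(1)[of B v i] by simp
qed

lemma perturb_lin_lattice: "v \<in> lin_lattice A' \<Longrightarrow> perturb (A - A') v \<in> lin_lattice A"
  by (simp add: lin_lattice_def vecmat_diff_right)

text \<open>A shear by A - A' adds q(A - A') to the last coordinates. Its valuation is at least (3 -
  nt) + (m + n)t = 3 + mt, exactly the bound in the box, so short vectors stay short.\<close>

lemma good_cong:
  fixes A A' :: "'m::finite \<Rightarrow> 'n::finite \<Rightarrow> 'a::{finite,field} fls"
  assumes "good A t" and close: "\<And>i j. val_ge (A i j - A' i j) (int (CARD('m + 'n) * t))"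
  shows "good A' t"
  unfolding good_iff
proof
  fix v assume v: "v \<in> lat_ball (lin_lattice A') (weight t) 0"
  have "val_ge (vecmat (v \<circ> Inl) (A - A') j) ((3 - int CARD('n) * int t) + int (CARD('m + 'n) * t))" for j
    by (rule val_ge_vecmat) (use v close in \<open>auto simp: lat_ball_def dest: spec[of _ "Inl _"]\<close>)
  moreover have "(3 - int CARD('n) * int t) + int (CARD('m + 'n) * t) = 3 + int CARD('m) * int t"
    by (simp add: algebra_simps)
  ultimately have B: "val_ge (vecmat (v \<circ> Inl) (A - A') j) (3 + int CARD('m) * int t)" for j
    by (simp only:)
  have "val_ge (perturb (A - A') v i) (weight t i)" for i
  proof (cases i)
    case (Inl a)
    then show ?thesis using v by (auto simp: lat_ball_def dest: spec[of _ "Inl a"])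
  next
    case (Inr j)
    then show ?thesis using v B[of j] by (auto simp: lat_ball_def intro!: val_ge_add dest: spec[of _ "Inr j"])
  qed
  then have "perturb (A - A') v \<in> lat_ball (lin_lattice A) (weight t) 0"
    using v by (auto simp: lat_ball_def intro: perturb_lin_lattice)
  then have "perturb (A - A') v = 0" using assms(1) by (simp add: good_iff)
  then have "v \<circ> Inl = 0" by (rule perturb_eq_0D)
  with v show "v = 0" by (rule lin_lattice_ball_eq_0)
qed

text \<open>A short vector u of A' at time t + T is sheared into the lattice of A. The level
  \<open>l\<close> is read off from the minimal valuation M of its q-part, via M = 3 - nt - l, and a
  coordinate attaining M has the nonzero coefficient. Shortness of u gives l \<le> nT.\<close>

lemma not_good_witness:
  fixes A A' :: "'m::finite \<Rightarrow> 'n::finite \<Rightarrow> 'a::{finite,field} fls"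
  assumes "good A t" and close: "\<And>i j. val_ge (A i j - A' i j) (int (CARD('m + 'n) * t))"
    and ng: "\<not> good A' (t + T)"
  obtains l v i where "1 \<le> l" "l \<le> CARD('n) * T" "v \<in> lat_ball (lin_lattice A) (weight t) l"
    "fls_nth (v (Inl i)) (3 - int CARD('n) * int t - int l) \<noteq> 0"
    "\<And>j. val_ge (v (Inr j) + vecmat (v \<circ> Inl) (A' - A) j) (3 + int CARD('m) * int (t + T))"
proof -
  obtain u where u: "u \<in> lat_ball (lin_lattice A') (weight (t + T)) 0" "u \<noteq> 0"
    using ng by (auto simp: good_iff)
  let ?q = "u \<circ> Inl"
  have q0: "?q \<noteq> 0" using lin_lattice_ball_eq_0[OF u(1)] u(2) by blast
  have uval: "val_ge (u (Inl i)) (3 - int CARD('n) * int (t + T))"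
      "val_ge (u (Inr j)) (3 + int CARD('m) * int (t + T))" for i j
    using u(1) by (auto simp: lat_ball_def dest: spec[of _ "Inl i"] spec[of _ "Inr j"])
  define M where "M = Min ((\<lambda>i. fls_subdegree (?q i)) ` {i. ?q i \<noteq> 0})"
  have ne: "{i. ?q i \<noteq> 0} \<noteq> {}" using q0 by (auto simp: fun_eq_iff)
  have "M \<in> (\<lambda>i. fls_subdegree (?q i)) ` {i. ?q i \<noteq> 0}"
    unfolding M_def by (rule Min_in) (use ne in auto)
  then obtain i0 where i0: "?q i0 \<noteq> 0" "M = fls_subdegree (?q i0)" by auto
  have M: "val_ge (?q i) M" for i
    unfolding val_ge_iff_subdegree M_def by (auto intro: Min_le)
  have MT: "3 - int CARD('n) * int (t + T) \<le> M"
    using uval(1)[of i0] i0 by (simp add: val_ge_iff_subdegree)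
  have B: "val_ge (vecmat ?q (A - A') j) (M + int (CARD('m + 'n) * t))" for j
    by (rule val_ge_vecmat) (use M close in auto)
  let ?v = "perturb (A - A') u"
  have v: "?v \<in> lin_lattice A"
    using u by (intro perturb_lin_lattice) (simp add: lat_ball_def)
  have vball: "?v \<in> lat_ball (lin_lattice A) (weight t) l" if "3 - int CARD('n) * int t - int l \<le> M" for l
  proof -
    have "val_ge (?v i) (weight t i - int l)" for i
    proof (cases i)
      case (Inl a)
      then show ?thesis using M[of a] that by (auto elim: val_ge_mono)
    next
      case (Inr j)
      have "val_ge (u (Inr j)) (3 + int CARD('m) * int t - int l)"
        by (rule val_ge_mono[OF uval(2)]) (simp add: algebra_simps)
      moreover have "val_ge (vecmat ?q (A - A') j) (3 + int CARD('m) * int t - int l)"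
        by (rule val_ge_mono[OF B]) (use that in \<open>simp add: algebra_simps\<close>)
      ultimately show ?thesis using Inr by (auto intro: val_ge_add)
    qed
    then show ?thesis using v by (simp add: lat_ball_def)
  qed
  \<comment> \<open>Otherwise the sheared vector would be short for A at time t, hence zero,
    although the shear preserves q \<noteq> 0.\<close>
  have "M < 3 - int CARD('n) * int t"
  proof (rule ccontr)
    assume "\<not> ?thesis"
    then have "?v = 0" using vball[of 0] assms(1) by (simp add: good_iff)
    then have "?q = 0" by (rule perturb_eq_0D)
    then show False using q0 by blast
  qed
  moreover define l where "l = nat (3 - int CARD('n) * int t - M)"
  ultimately have l: "3 - int CARD('n) * int t - M = int l" "1 \<le> l" by auto
  show thesis
  proof (rule that[of l ?v i0])
    have "int l \<le> int (CARD('n) * T)" using MT l by (simp add: algebra_simps)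
    then show "l \<le> CARD('n) * T" by linarith
    have "3 - int CARD('n) * int t - int l = M" using l by simp
    then show "fls_nth (?v (Inl i0)) (3 - int CARD('n) * int t - int l) \<noteq> 0"
      using i0 by simp
    \<comment> \<open>Shearing back by A' - A recovers the last coordinates of u.\<close>
    show "val_ge (?v (Inr j) + vecmat (?v \<circ> Inl) (A' - A) j) (3 + int CARD('m) * int (t + T))" for j
      using uval(2)[of j] by (simp add: vecmat_diff_right)
  qed (use l vball[of l] in auto)
qed

section \<open>Counting bad continuations\<close>

text \<open>The tree lives in the unit ball: entries have only nonnegative powers of Y, so digits
  are indexed by naturals.\<close>

definition digit_matrix :: "('m \<Rightarrow> 'n \<Rightarrow> nat \<Rightarrow> 'a::zero) \<Rightarrow> 'm \<Rightarrow> 'n \<Rightarrow> 'a fls" where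
  "digit_matrix x = (\<lambda>i j. fps_to_fls (Abs_fps (x i j)))"

lemma nth_digit_matrix [simp]:
  "fls_nth (digit_matrix x i j) z = (if z < 0 then 0 else x i j (nat z))"
  by (simp add: digit_matrix_def)

lemma val_ge_digit_matrix_diff:
  "val_ge (digit_matrix x i j - digit_matrix y i j) (int e) \<longleftrightarrow> (\<forall>l<e. x i j l = y i j l)"
  for x y :: "'m \<Rightarrow> 'n \<Rightarrow> nat \<Rightarrow> 'a::ab_group_add"
proof
  assume "val_ge (digit_matrix x i j - digit_matrix y i j) (int e)"
  then show "\<forall>l<e. x i j l = y i j l"
    by (auto simp: val_ge_def dest: spec[of _ "int _"])
qed (auto simp: val_ge_def)

definition blocks :: "nat \<Rightarrow> ('m::finite \<times> 'n::finite \<times> nat \<Rightarrow> 'a) set" where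
  "blocks D = PiE (UNIV \<times> UNIV \<times> {..<D}) (\<lambda>_. UNIV)"

lemma finite_blocks [simp]: "finite (blocks D :: ('m::finite \<times> 'n::finite \<times> nat \<Rightarrow> 'a::finite) set)"
  by (simp add: blocks_def finite_PiE)

lemma card_blocks:
  "card (blocks D :: ('m::finite \<times> 'n::finite \<times> nat \<Rightarrow> 'a::finite) set) = CARD('a) ^ (CARD('m) * CARD('n) * D)"
  by (simp add: blocks_def card_PiE card_cartesian_product mult.assoc)

lemma blocks_eqI:
  assumes "b \<in> blocks D" "b' \<in> blocks D" "\<And>i j l. l < D \<Longrightarrow> b (i, j, l) = b' (i, j, l)"
  shows "b = b'"
proof (rule PiE_ext)
  show "b \<in> PiE (UNIV \<times> UNIV \<times> {..<D}) (\<lambda>_. UNIV)" "b' \<in> PiE (UNIV \<times> UNIV \<times> {..<D}) (\<lambda>_. UNIV)"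
    using assms by (simp_all add: blocks_def)
qed (use assms(3) in auto)

text \<open>A child keeps the first \<open>P\<close> digits and takes the next \<open>D\<close> from
  a block. The zero tail merely selects a representative.\<close>

definition extend :: "nat \<Rightarrow> nat \<Rightarrow> ('m \<Rightarrow> 'n \<Rightarrow> nat \<Rightarrow> 'a::zero) \<Rightarrow> ('m \<times> 'n \<times> nat \<Rightarrow> 'a) \<Rightarrow> 'm \<Rightarrow> 'n \<Rightarrow> nat \<Rightarrow> 'a" where
  "extend P D x b = (\<lambda>i j l. if l < P then x i j l else if l < P + D then b (i, j, l - P) else 0)"

text \<open>Suppose two solutions agree off the first \<open>r\<close> digits of row
  \<open>i0\<close>. In the difference of their conditions only q_{i0} times the difference of that
  row survives, and cancelling q_{i0} makes these digits agree too. So n r of the digits are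
  determined by the others.\<close>

lemma card_blocks_small_form:
  fixes x :: "'m::finite \<Rightarrow> 'n::finite \<Rightarrow> nat \<Rightarrow> 'a::{finite,field}"
  assumes "fls_nth (q i0) a \<noteq> 0" and r: "r \<le> D"
  shows "card {b \<in> blocks D. \<forall>j. val_ge (y j + vecmat q (digit_matrix (extend P D x b) - A) j) (a + int (P + r))}
      \<le> CARD('a) ^ (CARD('m) * CARD('n) * D - CARD('n) * r)" (is "card ?B \<le> _")
proof -
  let ?I = "(UNIV :: 'm set) \<times> (UNIV :: 'n set) \<times> {..<D}"
  let ?J = "{i0} \<times> (UNIV :: 'n set) \<times> {..<r}"
  have inj: "inj_on (\<lambda>b. restrict b (?I - ?J)) ?B"
  proof (rule inj_onI)
    fix b b' assume b: "b \<in> ?B" "b' \<in> ?B" and eq: "restrict b (?I - ?J) = restrict b' (?I - ?J)"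
    let ?M = "\<lambda>b. digit_matrix (extend P D x b)"
    have off: "b (i, j, l) = b' (i, j, l)" if "l < D" "i \<noteq> i0 \<or> r \<le> l" for i j l
      using fun_cong[OF eq, of "(i, j, l)"] that by (auto simp: restrict_def split: if_splits)
    have row: "?M b i j = ?M b' i j" if "i \<noteq> i0" for i j
    proof -
      have "extend P D x b i j = extend P D x b' i j"
        using off[of _ i j] that by (auto simp: extend_def fun_eq_iff)
      then show ?thesis by (simp add: digit_matrix_def)
    qed
    have on: "b (i0, j, l) = b' (i0, j, l)" if "l < r" for j l
    proof -
      have "val_ge ((y j + vecmat q (?M b - A) j) - (y j + vecmat q (?M b' - A) j)) (a + int (P + r))"
        using b by (intro val_ge_diff) auto
      also have "(y j + vecmat q (?M b - A) j) - (y j + vecmat q (?M b' - A) j) = vecmat q (?M b - ?M b') j"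
        by (simp add: vecmat_diff_right)
      also have "\<dots> = q i0 * (?M b i0 j - ?M b' i0 j)"
        unfolding vecmat_def by (subst sum.mono_neutral_right[of _ "{i0}"]) (auto simp: row)
      finally have "val_ge (?M b i0 j - ?M b' i0 j) (int (P + r))"
        using assms(1) by (rule val_ge_mult_cancel)
      then have "extend P D x b i0 j (P + l) = extend P D x b' i0 j (P + l)"
        unfolding val_ge_digit_matrix_diff using that by auto
      then show ?thesis using that r by (simp add: extend_def)
    qed
    show "b = b'"
    proof (rule blocks_eqI[of _ D])
      fix i j l assume "l < D"
      then show "b (i, j, l) = b' (i, j, l)" using on[of l j] off[of l i j] by (cases "i = i0") force+
    qed (use b in auto)
  qed
  have fin: "finite (?I - ?J)" by simp
  have "card ?B = card ((\<lambda>b. restrict b (?I - ?J)) ` ?B)" using card_image[OF inj] by simp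
  also have "\<dots> \<le> card (PiE (?I - ?J) (\<lambda>_. UNIV :: 'a set))"
  proof (rule card_mono)
    show "(\<lambda>b. restrict b (?I - ?J)) ` ?B \<subseteq> PiE (?I - ?J) (\<lambda>_. UNIV)"
      by (intro image_subsetI restrict_PiE_iff[THEN iffD2]) simp
  qed (use fin in \<open>simp add: finite_PiE\<close>)
  also have "\<dots> = CARD('a) ^ card (?I - ?J)" using fin by (simp add: card_PiE)
  also have "card (?I - ?J) = CARD('m) * CARD('n) * D - CARD('n) * r"
    using r by (subst card_Diff_subset) (auto simp: card_cartesian_product mult.assoc)
  finally show ?thesis .
qed

lemma sum_power_le:
  fixes K :: nat
  assumes "2 \<le> K"
  shows "(\<Sum>l<a. K ^ l) \<le> K ^ a"
proof (induction a)
  case (Suc a)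
  then have "(\<Sum>l<Suc a. K ^ l) \<le> 2 * K ^ a" by simp
  also have "\<dots> \<le> K * K ^ a" using assms by (rule mult_right_mono) simp
  finally show ?case by simp
qed simp

text \<open>The l-th summand counts the refinements that make short one of the c l lattice points of level l;
  the levels below s, where only the trivial bound holds, are negligible because T is large.\<close>
lemma child_count_sum:
  fixes k m n T s :: nat and c :: "nat \<Rightarrow> nat"
  assumes k: "2 \<le> k" and m: "1 \<le> m" and n: "1 \<le> n"
    and small: "\<And>l. c l \<le> k ^ ((m + n) * l)"
    and large: "\<And>l. s \<le> l \<Longrightarrow> c l \<le> k ^ ((m + n) * (l - 2))"
    and s: "2 \<le> s" and T: "s + 3 \<le> T"
  defines "D \<equiv> (m + n) * T"
  shows "4 * (\<Sum>l=1..n*T. c l * k ^ (m * n * D - n * (m * T + l))) \<le> k ^ (m * n * D)"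
proof -
  \<comment> \<open>Chosen so that the trivial bound on \<open>c l\<close> turns the
    \<open>l\<close>-th summand into k^{E + m l}: a geometric progression whose exponent reaches m n
    D at l = n T.\<close>
  define E where "E = m * n * D - m * n * T"
  let ?f = "\<lambda>l. c l * k ^ (m * n * D - n * (m * T + l))"
  have TD: "T \<le> D" using m unfolding D_def by simp
  have E: "m * n * D = E + m * n * T"
    unfolding E_def using TD by simp
  have nl: "n * (m * T + l) \<le> m * n * D" if "l \<le> n * T" for l
  proof -
    have "n * (m * T + l) \<le> n * D" using that by (simp add: D_def algebra_simps)
    also have "\<dots> \<le> m * n * D" using m by simp
    finally show ?thesis .
  qed
  have sT: "s + 3 \<le> n * T" using T n by (metis One_nat_def le_trans mult_le_mono1 nat_mult_1)
  have e1: "(m + n) * l + (m * n * D - n * (m * T + l)) = E + m * l" if "l \<le> n * T" for l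
    using nl[OF that] E by (simp add: algebra_simps)
  have k2: "2 \<le> k ^ m" using k m by (metis One_nat_def le_trans one_le_numeral power_increasing power_one_right numeral_le_one_iff semiring_norm(69))
  have geo: "(\<Sum>l<a. k ^ (E + m * l)) \<le> k ^ (E + m * a)" for a
    using sum_power_le[OF k2, of a] by (simp add: power_add power_mult flip: sum_distrib_left)
  have f1: "?f l \<le> k ^ (E + m * l)" if "l \<le> n * T" for l
    using mult_right_mono[OF small[of l], of "k ^ (m * n * D - n * (m * T + l))"] e1[OF that]
    by (simp flip: power_add)
  have f2: "k ^ (2 * (m + n)) * ?f l \<le> k ^ (E + m * l)" if "s \<le> l" "l \<le> n * T" for l
  proof -
    have "k ^ (2 * (m + n)) * ?f l \<le> k ^ (2 * (m + n)) * (k ^ ((m + n) * (l - 2)) * k ^ (m * n * D - n * (m * T + l)))"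
      using large[OF that(1)] by simp
    also have "\<dots> = k ^ ((m + n) * l + (m * n * D - n * (m * T + l)))"
    proof -
      have "2 * (m + n) + (m + n) * (l - 2) = (m + n) * l"
        using that s by (metis add_mult_distrib2 le_add_diff_inverse le_trans mult.commute)
      then show ?thesis by (metis power_add mult.assoc)
    qed
    finally show ?thesis using e1[OF that(2)] by simp
  qed
  \<comment> \<open>The short range ends near E + m s; as 8 \<le> (k^m)^3, three further steps of
    the progression absorb the constant.\<close>
  have A: "8 * (\<Sum>l=1..<s. ?f l) \<le> k ^ (m * n * D)"
  proof -
    have "(\<Sum>l=1..<s. ?f l) \<le> (\<Sum>l=1..<s. k ^ (E + m * l))"
      by (intro sum_mono f1) (use sT in auto)
    also have "\<dots> \<le> (\<Sum>l<s. k ^ (E + m * l))" by (intro sum_mono2) auto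
    also have "\<dots> \<le> k ^ (E + m * s)" by (rule geo)
    finally have "8 * (\<Sum>l=1..<s. ?f l) \<le> 2 ^ 3 * k ^ (E + m * s)" by simp
    also have "\<dots> \<le> (k ^ m) ^ 3 * k ^ (E + m * s)"
      by (intro mult_right_mono power_mono k2) auto
    also have "\<dots> = k ^ (E + m * (s + 3))"
      by (simp add: power_add power_mult distrib_left mult_ac)
    also have "\<dots> \<le> k ^ (m * n * D)"
      unfolding E using k sT by (intro power_increasing) (auto simp: mult.assoc)
    finally show ?thesis .
  qed
  \<comment> \<open>Here \<open>l - 2\<close> in place of \<open>l\<close> saves k^{2(m+n)}, which
    pays for 8 \<le> k^3 and for the factor k^m lost in summing the progression, since 3 + m \<le>
    2(m + n).\<close>
  have B: "8 * (\<Sum>l=s..n*T. ?f l) \<le> k ^ (m * n * D)"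
  proof -
    have "k ^ m * (8 * (\<Sum>l=s..n*T. ?f l)) = (2 ^ 3 * k ^ m) * (\<Sum>l=s..n*T. ?f l)" by simp
    also have "\<dots> \<le> (k ^ 3 * k ^ m) * (\<Sum>l=s..n*T. ?f l)"
      using k by (intro mult_right_mono power_mono) auto
    also have "\<dots> \<le> k ^ (2 * (m + n)) * (\<Sum>l=s..n*T. ?f l)"
      unfolding power_add[symmetric] using k m n by (intro mult_right_mono power_increasing) auto
    also have "\<dots> \<le> (\<Sum>l=s..n*T. k ^ (E + m * l))"
      unfolding sum_distrib_left by (intro sum_mono f2) auto
    also have "\<dots> \<le> (\<Sum>l<Suc (n*T). k ^ (E + m * l))" by (intro sum_mono2) auto
    also have "\<dots> \<le> k ^ (E + m * Suc (n * T))" by (rule geo)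
    also have "\<dots> = k ^ m * k ^ (m * n * D)"
      unfolding E by (simp add: mult.assoc add_ac flip: power_add)
    finally show ?thesis using k by simp
  qed
  have "{1..n*T} = {1..<s} \<union> {s..n*T}" using s sT by auto
  then have "(\<Sum>l=1..n*T. ?f l) = (\<Sum>l=1..<s. ?f l) + (\<Sum>l=s..n*T. ?f l)"
    by (simp add: sum.union_disjoint ivl_disj_int)
  then show ?thesis using A B by linarith
qed

lemma card_UN_le_mult:
  assumes "finite I" "\<And>i. i \<in> I \<Longrightarrow> card (X i) \<le> c"
  shows "card (\<Union>i\<in>I. X i) \<le> card I * c"
proof -
  have "card (\<Union>i\<in>I. X i) \<le> (\<Sum>i\<in>I. card (X i))" by (rule card_UN_le[OF assms(1)])
  also have "\<dots> \<le> (\<Sum>i\<in>I. c)" using assms(2) by (rule sum_mono)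
  finally show ?thesis by simp
qed

text \<open>A union bound over the witnesses: \<open>W l\<close> holds the lattice points of level
  \<open>l\<close> with a nonzero leading q-coefficient, and \<open>Bd v\<close> the blocks for
  which \<open>v\<close> becomes short.\<close>

lemma card_bad_children:
  fixes x :: "'m::finite \<Rightarrow> 'n::finite \<Rightarrow> nat \<Rightarrow> 'a::{finite,field}"
  assumes g: "good (digit_matrix x) t" and T: "CARD('a) ^ (CARD('m + 'n) * 2) + 3 \<le> T"
  defines "D \<equiv> CARD('m + 'n) * T" and "P \<equiv> CARD('m + 'n) * t"
  shows "4 * card {b \<in> blocks D. \<not> good (digit_matrix (extend P D x b)) (t + T)} \<le> card (blocks D :: ('m \<times> 'n \<times> nat \<Rightarrow> 'a) set)"
proof -
  interpret poly_lattice "lin_lattice (digit_matrix x)" by (rule poly_lattice_lin_lattice)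
  let ?k = "CARD('a)" let ?m = "CARD('m)" let ?n = "CARD('n)"
  let ?A = "digit_matrix x" let ?M = "\<lambda>b. digit_matrix (extend P D x b)"
  define V where "V = lat_ball (lin_lattice ?A) (weight t)"
  have V0: "lat_ball (lin_lattice ?A) (weight t) 0 = {0}" using g by (simp add: good_def)
  define W where "W = (\<lambda>l. {v \<in> V l. \<exists>i. fls_nth (v (Inl i)) (3 - int ?n * int t - int l) \<noteq> 0})"
  define Bd where "Bd = (\<lambda>v. {b \<in> (blocks D :: ('m \<times> 'n \<times> nat \<Rightarrow> 'a) set).
      \<forall>j. val_ge (v (Inr j) + vecmat (v \<circ> Inl) (?M b - ?A) j) (3 + int ?m * int (t + T))})"
  have sub: "{b \<in> blocks D. \<not> good (?M b) (t + T)} \<subseteq> (\<Union>l\<in>{1..?n * T}. \<Union>v\<in>W l. Bd v)"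
  proof safe
    fix b :: "'m \<times> 'n \<times> nat \<Rightarrow> 'a" assume b: "b \<in> blocks D" "\<not> good (?M b) (t + T)"
    have close: "val_ge (?A i j - ?M b i j) (int (CARD('m + 'n) * t))" for i j
      unfolding val_ge_digit_matrix_diff by (simp add: extend_def P_def)
    obtain l v i where lv: "1 \<le> l" "l \<le> ?n * T" "v \<in> lat_ball (lin_lattice ?A) (weight t) l"
      "fls_nth (v (Inl i)) (3 - int ?n * int t - int l) \<noteq> 0"
      "\<And>j. val_ge (v (Inr j) + vecmat (v \<circ> Inl) (?M b - ?A) j) (3 + int ?m * int (t + T))"
      using not_good_witness[OF g close b(2)] by blast
    then have "v \<in> W l" "b \<in> Bd v" using b(1) by (auto simp: W_def V_def Bd_def)
    then show "b \<in> (\<Union>l\<in>{1..?n * T}. \<Union>v\<in>W l. Bd v)" using lv(1,2) by auto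
  qed
  have finV: "finite (V l)" for l unfolding V_def by (rule finite_lat_ball[OF V0])
  have finW: "finite (W l)" and cW: "card (W l) \<le> card (V l)" for l
    using finV[of l] by (auto simp: W_def intro: card_mono)
  have cB: "card (Bd v) \<le> ?k ^ (?m * ?n * D - ?n * (?m * T + l))" if "l \<in> {1..?n * T}" "v \<in> W l" for l v
  proof -
    obtain i where i: "fls_nth ((v \<circ> Inl) i) (3 - int ?n * int t - int l) \<noteq> 0" using \<open>v \<in> W l\<close> by (auto simp: W_def)
    \<comment> \<open>The condition prescribes mT + l digits beyond \<open>P\<close>: adding P = (m
      + n)t and this number to the valuation 3 - nt - l gives 3 + m(t + T).\<close>
    have "?m * T + l \<le> D" using that by (simp add: D_def algebra_simps)
    from card_blocks_small_form[where q = "v \<circ> Inl" and y = "v \<circ> Inr" and P = P and x = x and A = ?A, OF i this]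
    have "card {b \<in> blocks D. \<forall>j. val_ge ((v \<circ> Inr) j + vecmat (v \<circ> Inl) (?M b - ?A) j)
        (3 - int ?n * int t - int l + int (P + (?m * T + l)))} \<le> ?k ^ (?m * ?n * D - ?n * (?m * T + l))" .
    moreover have "3 - int ?n * int t - int l + int (P + (?m * T + l)) = 3 + int ?m * int (t + T)"
      by (simp add: P_def algebra_simps)
    ultimately show ?thesis by (simp only: Bd_def o_apply)
  qed
  have "card {b \<in> blocks D. \<not> good (?M b) (t + T)} \<le> card (\<Union>l\<in>{1..?n * T}. \<Union>v\<in>W l. Bd v)"
    by (rule card_mono[OF _ sub]) (auto simp: Bd_def finW)
  also have "\<dots> \<le> (\<Sum>l=1..?n * T. card (\<Union>v\<in>W l. Bd v))"
    by (rule card_UN_le) simp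
  also have "\<dots> \<le> (\<Sum>l=1..?n * T. card (W l) * ?k ^ (?m * ?n * D - ?n * (?m * T + l)))"
    by (intro sum_mono card_UN_le_mult finW cB)
  also have "\<dots> \<le> (\<Sum>l=1..?n * T. card (V l) * ?k ^ (?m * ?n * D - ?n * (?m * T + l)))"
    by (intro sum_mono mult_right_mono cW) simp
  finally have 1: "card {b \<in> blocks D. \<not> good (?M b) (t + T)} \<le> \<dots>" .
  have "4 * (\<Sum>l=1..?n*T. card (V l) * ?k ^ (?m * ?n * ((?m + ?n) * T) - ?n * (?m * T + l))) \<le> ?k ^ (?m * ?n * ((?m + ?n) * T))"
  \<comment> \<open>The threshold is k^{d a} with defect a = 2 and d = m + n, from which level on
    the exact lattice count holds.\<close>
  proof (rule child_count_sum[where s = "?k ^ (CARD('m + 'n) * 2)"])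
    show "2 \<le> ?k" by (rule card_field_ge_2)
    show "1 \<le> ?m" "1 \<le> ?n" by (simp_all add: Suc_le_eq)
    show "card (V l) \<le> ?k ^ ((?m + ?n) * l)" for l
      using card_lat_ball_le[OF V0, of l] by (simp add: V_def)
    show "card (V l) \<le> ?k ^ ((?m + ?n) * (l - 2))" if "?k ^ (CARD('m + 'n) * 2) \<le> l" for l
      using card_lat_ball_eventually[OF V0 card_lin_lattice_ball_large that] by (simp add: V_def)
    show "2 \<le> ?k ^ (CARD('m + 'n) * 2)"
    proof -
      have "2 ^ 1 \<le> ?k ^ 1" using card_field_ge_2[where 'a='a] by simp
      also have "\<dots> \<le> ?k ^ (CARD('m + 'n) * 2)"
        using card_field_ge_2[where 'a='a] by (intro power_increasing) (auto simp: Suc_le_eq)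
      finally show ?thesis by simp
    qed
  qed (rule T)
  then have "4 * (\<Sum>l=1..?n*T. card (V l) * ?k ^ (?m * ?n * D - ?n * (?m * T + l))) \<le> card (blocks D :: ('m \<times> 'n \<times> nat \<Rightarrow> 'a) set)"
    by (simp add: card_blocks D_def)
  with 1 show ?thesis by linarith
qed

section \<open>The lower bound\<close>

text \<open>For given q let \<open>Suc N\<close> be the first index at which q fits into the box.
  Failure at \<open>N\<close> bounds the norm of q from below, and goodness at time T(N + 1) bounds
  the distance of qA to the polynomials from below. Consecutive times differ by the fixed T, so the
  product of the two bounds does not depend on q.\<close>

lemma badly_approxI:
  fixes A :: "'m::finite \<Rightarrow> 'n::finite \<Rightarrow> 'a::{finite,field} fls"
  assumes T: "0 < T" and good: "\<And>N. good A (T * N)"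
  shows "A \<in> badly_approx"
proof -
  let ?m = "int CARD('m)" let ?n = "int CARD('n)"
  define k where "k = real CARD('a)"
  have k: "1 < k" using card_field_ge_2[where 'a='a] by (simp add: k_def)
  \<comment> \<open>The product of the two bounds is k^{-3n - mnT - 3m}; the extra -1 makes the
    inequality strict.\<close>
  define K where "K = k powi (- 3 * ?n - ?m * ?n * int T - 3 * ?m - 1)"
  have "dist_poly (vecmat q A) ^ CARD('n) > K / vnorm q ^ CARD('m)"
    if q: "\<And>i. is_poly (q i)" and q0: "q \<noteq> (\<lambda>_. 0)" for q
  proof -
    define P where "P = (\<lambda>N. \<forall>i. val_ge (q i) (3 - ?n * int (T * N)))"
    have "\<exists>N. P N"
    proof -
      define N where "N = nat (3 + (\<Sum>i\<in>UNIV. \<bar>fls_subdegree (q i)\<bar>))"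
      have "val_ge (q i) (3 - ?n * int (T * N))" for i
      proof -
        have "\<bar>fls_subdegree (q i)\<bar> \<le> (\<Sum>i\<in>UNIV. \<bar>fls_subdegree (q i)\<bar>)"
          by (rule member_le_sum) auto
        then have "3 - int N \<le> fls_subdegree (q i)" by (simp add: N_def)
        moreover have "int N \<le> ?n * int (T * N)"
        proof -
          have "1 * N \<le> (CARD('n) * T) * N" using T by (intro mult_right_mono) (auto simp: Suc_le_eq)
          then have "int N \<le> int (CARD('n) * T * N)" by (simp only: of_nat_le_iff mult_1)
          then show ?thesis by (simp add: mult.assoc)
        qed
        ultimately show ?thesis by (simp add: val_ge_iff_subdegree)
      qed
      then show ?thesis unfolding P_def by blast
    qed
    then have PN: "P (LEAST N. P N)" by (rule LeastI_ex)
    \<comment> \<open>At index 0 the box forces |q_i| < 1, which only the zero polynomial satisfies;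
      so the least index is a successor.\<close>
    have "\<not> P 0"
    proof
      assume "P 0"
      then have "q i = 0" for i
        by (intro is_poly_val_ge_imp_0 q) (auto simp: P_def intro: val_ge_mono[of _ 3])
      then show False using q0 by auto
    qed
    with PN obtain N where N: "(LEAST N. P N) = Suc N" by (metis not0_implies_Suc)
    then have "\<not> P N" using not_less_Least[of N P] by simp
    then obtain i where "\<not> val_ge (q i) (3 - ?n * int (T * N))" by (auto simp: P_def)
    then have "\<not> lsabs (q i) \<le> k powi (- (3 - ?n * int (T * N)))"
      unfolding k_def lsabs_le_iff .
    then have "\<not> vnorm q \<le> k powi (- (3 - ?n * int (T * N)))"
      unfolding vnorm_le_iff by blast
    then have nq: "k powi (- (3 - ?n * int (T * N))) \<le> vnorm q" by simp
    have dq: "k powi (- (3 + ?m * int (T * Suc N))) \<le> dist_poly (vecmat q A)"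
      unfolding dist_poly_def
    proof (rule cInf_greatest)
      show "{vnorm (\<lambda>i. vecmat q A i - p i) |p. \<forall>i. is_poly (p i)} \<noteq> {}"
        by (auto intro!: exI[of _ "\<lambda>_. 0"] simp: is_poly_def)
      fix z assume "z \<in> {vnorm (\<lambda>i. vecmat q A i - p i) |p. \<forall>i. is_poly (p i)}"
      then obtain p where p: "z = vnorm (\<lambda>i. vecmat q A i - p i)" "\<And>i. is_poly (p i)" by blast
      let ?v = "case_sum q (\<lambda>j. vecmat q A j - p j)"
      have comp: "?v \<circ> Inl = q" by auto
      have "?v \<in> lin_lattice A" using q p(2) by (simp add: lin_lattice_def comp)
      moreover have "?v \<noteq> 0" using q0 comp by (metis comp_def zero_fun_def)
      ultimately have "\<not> (\<forall>i. val_ge (?v i) (weight (T * Suc N) i))"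
        using good[of "Suc N"] unfolding good_iff lat_ball_def by auto
      then obtain i where i: "\<not> val_ge (?v i) (weight (T * Suc N) i)" by blast
      have "\<exists>j. \<not> val_ge (vecmat q A j - p j) (3 + ?m * int (T * Suc N))"
      proof (cases i)
        case (Inl a)
        then show ?thesis using i PN unfolding N by (simp add: P_def algebra_simps)
      next
        case (Inr j)
        then show ?thesis using i by auto
      qed
      then have "\<not> z \<le> k powi (- (3 + ?m * int (T * Suc N)))"
        unfolding p vnorm_le_iff k_def lsabs_le_iff by blast
      then show "k powi (- (3 + ?m * int (T * Suc N))) \<le> z" by simp
    qed
    have pw: "(k powi e) ^ j = k powi (e * int j)" for e j
      by (simp add: power_int_mult)
    have "K / vnorm q ^ CARD('m) \<le> K / (k powi (- (3 - ?n * int (T * N)))) ^ CARD('m)"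
      using nq k by (intro divide_left_mono power_mono mult_pos_pos zero_less_power) (auto simp: K_def intro: less_le_trans[OF _ nq])
    also have "\<dots> = k powi ((- 3 * ?n - ?m * ?n * int T - 3 * ?m - 1) - (- (3 - ?n * int (T * N))) * ?m)"
      unfolding pw K_def using k by (subst power_int_diff) auto
    also have "\<dots> < k powi ((- (3 + ?m * int (T * Suc N))) * ?n)"
      using k by (intro power_int_strict_increasing) (auto simp: algebra_simps)
    also have "\<dots> = (k powi (- (3 + ?m * int (T * Suc N)))) ^ CARD('n)" by (simp only: pw)
    also have "\<dots> \<le> dist_poly (vecmat q A) ^ CARD('n)"
      using dq k by (intro power_mono) auto
    finally show ?thesis .
  qed
  moreover have "K > 0" using k by (simp add: K_def)
  ultimately show ?thesis unfolding badly_approx_def by blast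
qed

section \<open>Choosing a branch of the tree that avoids a cheap cover\<close>

lemma sum_suminf_disjoint_le:
  fixes f :: "nat \<Rightarrow> ennreal"
  assumes G: "finite G" and disj: "\<And>b b' y. b \<in> G \<Longrightarrow> b' \<in> G \<Longrightarrow> y \<in> S b \<Longrightarrow> y \<in> S b' \<Longrightarrow> b = b'"
    and sub: "\<And>b. b \<in> G \<Longrightarrow> S b \<subseteq> U"
  shows "(\<Sum>b\<in>G. \<Sum>i. if c i \<in> S b then f i else 0) \<le> (\<Sum>i. if c i \<in> U then f i else 0)"
proof -
  have "(\<Sum>b\<in>G. \<Sum>i. if c i \<in> S b then f i else 0) = (\<Sum>i. \<Sum>b\<in>G. if c i \<in> S b then f i else 0)"
    by (rule suminf_sum[symmetric]) simp
  also have "\<dots> \<le> (\<Sum>i. if c i \<in> U then f i else 0)"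
  proof (rule suminf_le)
    fix i
    show "(\<Sum>b\<in>G. if c i \<in> S b then f i else 0) \<le> (if c i \<in> U then f i else 0)"
    proof (cases "\<exists>b\<in>G. c i \<in> S b")
      case True
      then obtain b where b: "b \<in> G" "c i \<in> S b" by blast
      have "(\<Sum>b\<in>G. if c i \<in> S b then f i else 0) = (\<Sum>b\<in>{b}. if c i \<in> S b then f i else 0)"
        using G b disj by (intro sum.mono_neutral_right) auto
      then show ?thesis using b sub by auto
    next
      case False
      then have "(\<Sum>b\<in>G. if c i \<in> S b then f i else 0) = 0" by (intro sum.neutral) auto
      then show ?thesis by simp
    qed
  qed auto
  finally show ?thesis .
qed

text \<open>The closed ball of radius k^{-P} fixed by the first \<open>P\<close> digits of
  \<open>x\<close>.\<close>

definition node :: "nat \<Rightarrow> ('m \<Rightarrow> 'n \<Rightarrow> nat \<Rightarrow> 'a::ab_group_add) \<Rightarrow> ('m \<Rightarrow> 'n \<Rightarrow> 'a fls) set" where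
  "node P x = {y. \<forall>i j. val_ge (y i j - digit_matrix x i j) (int P)}"

lemma node_eqD:
  assumes "y \<in> node P x" "y \<in> node P x'" "l < P"
  shows "x i j l = x' i j l"
proof -
  have "val_ge ((y i j - digit_matrix x' i j) - (y i j - digit_matrix x i j)) (int P)"
    by (rule val_ge_diff) (use assms in \<open>auto simp: node_def\<close>)
  then have "val_ge (digit_matrix x i j - digit_matrix x' i j) (int P)" by simp
  then show ?thesis using assms(3) by (simp add: val_ge_digit_matrix_diff)
qed

lemma node_mono:
  assumes "P \<le> P'" "\<And>i j l. l < P \<Longrightarrow> x' i j l = x i j l"
  shows "node P' x' \<subseteq> node P x"
proof
  fix y assume y: "y \<in> node P' x'"
  have "val_ge ((y i j - digit_matrix x' i j) + (digit_matrix x' i j - digit_matrix x i j)) (int P)" for i j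
  proof (rule val_ge_add)
    show "val_ge (y i j - digit_matrix x' i j) (int P)"
      using y assms(1) by (auto simp: node_def intro: val_ge_mono[of _ "int P'"])
  qed (simp add: val_ge_digit_matrix_diff assms(2))
  then show "y \<in> node P x" by (simp add: node_def)
qed

text \<open>Pigeonhole: at least half of the children are good, their nodes are disjoint and lie in
  the parent node. If each carried s-length at least \<open>C'\<close>, the parent would carry at
  least \<open>C\<close>.\<close>

lemma good_child_step:
  fixes x :: "'m::finite \<Rightarrow> 'n::finite \<Rightarrow> nat \<Rightarrow> 'a::{finite,field}" and f :: "nat \<Rightarrow> ennreal"
  assumes T: "CARD('a) ^ (CARD('m + 'n) * 2) + 3 \<le> T"
    and g: "good (digit_matrix x) (T * N)"
  defines "D \<equiv> CARD('m + 'n) * T"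
  assumes small: "(\<Sum>i. if c i \<in> node (D * N) x then f i else 0) < ennreal C"
    and C': "0 \<le> C'" "C \<le> real (CARD('a) ^ (CARD('m) * CARD('n) * D)) / 2 * C'"
  shows "\<exists>y. (good (digit_matrix y) (T * Suc N) \<and> (\<Sum>i. if c i \<in> node (D * Suc N) y then f i else 0) < ennreal C')
      \<and> (\<forall>i j. \<forall>l<D * N. y i j l = x i j l)"
proof (rule ccontr)
  assume contra: "\<not> ?thesis"
  let ?y = "extend (D * N) D x"
  define G where "G = {b \<in> (blocks D :: ('m \<times> 'n \<times> nat \<Rightarrow> 'a) set). good (digit_matrix (?y b)) (T * Suc N)}"
  let ?M = "CARD('a) ^ (CARD('m) * CARD('n) * D)"
  have ge: "ennreal C' \<le> (\<Sum>i. if c i \<in> node (D * Suc N) (?y b) then f i else 0)" if "b \<in> G" for b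
    using contra that unfolding G_def by (force simp: extend_def not_less)
  have "4 * card {b \<in> (blocks D :: ('m \<times> 'n \<times> nat \<Rightarrow> 'a) set). \<not> good (digit_matrix (?y b)) (T * Suc N)} \<le> ?M"
    using card_bad_children[OF g T] by (simp add: D_def card_blocks mult.assoc add.commute)
  moreover have "card {b \<in> (blocks D :: ('m \<times> 'n \<times> nat \<Rightarrow> 'a) set). \<not> good (digit_matrix (?y b)) (T * Suc N)} + card G = ?M"
    unfolding G_def card_blocks[symmetric]
    by (subst card_Un_disjoint[symmetric]) (auto intro!: arg_cong[of _ _ card])
  ultimately have "real ?M / 2 \<le> real (card G)" by linarith
  then have "C \<le> real (card G) * C'" using C' by (meson mult_right_mono order_trans)
  then have "ennreal C \<le> of_nat (card G) * ennreal C'"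
    using C' by (simp add: ennreal_mult ennreal_leI flip: ennreal_of_nat_eq_real_of_nat)
      (metis ennreal_leI ennreal_mult ennreal_of_nat_eq_real_of_nat of_nat_0_le_iff)
  also have "\<dots> = (\<Sum>b\<in>G. ennreal C')" by simp
  also have "\<dots> \<le> (\<Sum>b\<in>G. \<Sum>i. if c i \<in> node (D * Suc N) (?y b) then f i else 0)"
    by (rule sum_mono[OF ge])
  also have "\<dots> \<le> (\<Sum>i. if c i \<in> node (D * N) x then f i else 0)"
  proof (rule sum_suminf_disjoint_le)
    show "finite G" by (simp add: G_def)
    show "b = b'" if "b \<in> G" "b' \<in> G" "y \<in> node (D * Suc N) (?y b)" "y \<in> node (D * Suc N) (?y b')" for b b' y
    proof (rule blocks_eqI[of _ D])
      fix i j l assume "l < D"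
      then show "b (i, j, l) = b' (i, j, l)"
        using node_eqD[OF that(3,4), of "D * N + l" i j] by (simp add: extend_def)
    qed (use that in \<open>auto simp: G_def\<close>)
    show "node (D * Suc N) (?y b) \<subseteq> node (D * N) x" for b
      by (rule node_mono) (auto simp: extend_def)
  qed
  finally show False using small by simp
qed

text \<open>A cover that is too cheap is refuted by following light good children. Their limit is
  badly approximable, so some ball \<open>i\<close> contains it. At the level N where \<beta>^{-N-1}
  < \<rho> i \<le> \<beta>^{-N}, the centre of this ball lies in the chosen node, so the ball alone
  exceeds the s-length permitted there.\<close>

lemma hausdorff_pre_badly_approx_ge:
  fixes s :: real
  assumes T: "CARD('a) ^ (CARD('m + 'n) * 2) + 3 \<le> T" and s: "0 \<le> s"
  defines "D \<equiv> CARD('m + 'n) * T"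
  defines "\<beta> \<equiv> real CARD('a) ^ D"
  assumes big: "2 * \<beta> powr s \<le> \<beta> ^ (CARD('m) * CARD('n))"
  shows "ennreal ((1 / \<beta>) powr s) \<le>
    hausdorff_pre mdist s 1 (badly_approx :: ('m::finite \<Rightarrow> 'n::finite \<Rightarrow> 'a::{finite,field} fls) set)"
  unfolding hausdorff_pre_def
proof (rule INF_greatest, clarify, rule ccontr)
  fix c :: "nat \<Rightarrow> 'm \<Rightarrow> 'n \<Rightarrow> 'a fls" and \<rho> :: "nat \<Rightarrow> real"
  assume \<rho>: "\<forall>i. 0 < \<rho> i \<and> \<rho> i \<le> 1" and cover: "badly_approx \<subseteq> (\<Union>i. {y. mdist y (c i) \<le> \<rho> i})"
    and "\<not> ennreal ((1 / \<beta>) powr s) \<le> (\<Sum>i. ennreal (\<rho> i powr s))"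
  then have total: "(\<Sum>i. ennreal (\<rho> i powr s)) < ennreal ((1 / \<beta>) powr s)" by simp
  have k: "1 < real CARD('a)" using card_field_ge_2[where 'a='a] by simp
  have T0: "0 < T" using T by simp
  have D0: "0 < D" using T0 by (simp add: D_def)
  have \<beta>: "1 < \<beta>" unfolding \<beta>_def using k D0 by (rule one_less_power)
  \<comment> \<open>The exponent \<open>Suc N\<close> is the lower end of the range of radii
    belonging to level \<open>N\<close>.\<close>
  define C where "C = (\<lambda>N. ((1 / \<beta>) ^ Suc N) powr s)"
  define \<phi> where "\<phi> = (\<lambda>N x. \<Sum>i. if c i \<in> node (D * N) x then ennreal (\<rho> i powr s) else 0)"
  have Cstep: "C N \<le> real (CARD('a) ^ (CARD('m) * CARD('n) * D)) / 2 * C (Suc N)" for N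
  proof -
    have M: "real (CARD('a) ^ (CARD('m) * CARD('n) * D)) = \<beta> ^ (CARD('m) * CARD('n))"
      by (simp add: \<beta>_def mult.commute flip: power_mult)
    have "C N = \<beta> powr s * C (Suc N)"
      using \<beta> by (simp add: C_def flip: powr_mult)
    also have "\<dots> \<le> \<beta> ^ (CARD('m) * CARD('n)) / 2 * C (Suc N)"
      using big by (intro mult_right_mono) (auto simp: C_def)
    finally show ?thesis unfolding M .
  qed
  have "\<exists>X. \<forall>N. (good (digit_matrix (X N :: 'm \<Rightarrow> 'n \<Rightarrow> nat \<Rightarrow> 'a)) (T * N) \<and> \<phi> N (X N) < ennreal (C N))
      \<and> (\<forall>i j. \<forall>l<D * N. X (Suc N) i j l = X N i j l)"
  proof (rule dependent_nat_choice)
    have "good (digit_matrix (\<lambda>(_::'m) (_::'n) _. 0 :: 'a)) (T * 0)"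
      unfolding good_iff
    proof
      fix v :: "'m + 'n \<Rightarrow> 'a fls"
      assume v: "v \<in> lat_ball (lin_lattice (digit_matrix (\<lambda>_ _ _. 0))) (weight (T * 0)) 0"
      have "(v \<circ> Inl) i = 0" for i
        using v unfolding lat_ball_def lin_lattice_def
        by (auto intro!: is_poly_val_ge_imp_0 dest!: spec[of _ "Inl i"] elim: val_ge_mono)
      then have "v \<circ> Inl = 0" by (simp add: fun_eq_iff)
      with v show "v = 0" by (rule lin_lattice_ball_eq_0)
    qed
    moreover have "\<phi> 0 x < ennreal (C 0)" for x
    proof -
      have "\<phi> 0 x \<le> (\<Sum>i. ennreal (\<rho> i powr s))"
        unfolding \<phi>_def by (intro suminf_le) auto
      then show ?thesis using total by (simp add: C_def)
    qed
    ultimately show "\<exists>x :: 'm \<Rightarrow> 'n \<Rightarrow> nat \<Rightarrow> 'a. good (digit_matrix x) (T * 0) \<and> \<phi> 0 x < ennreal (C 0)"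
      by blast
  next
    fix x :: "'m \<Rightarrow> 'n \<Rightarrow> nat \<Rightarrow> 'a" and N
    assume x: "good (digit_matrix x) (T * N) \<and> \<phi> N x < ennreal (C N)"
    show "\<exists>y. (good (digit_matrix y) (T * Suc N) \<and> \<phi> (Suc N) y < ennreal (C (Suc N))) \<and>
        (\<forall>i j. \<forall>l<D * N. y i j l = x i j l)"
      unfolding \<phi>_def D_def
      by (rule good_child_step[OF T]) (use x Cstep[of N] in \<open>auto simp: \<phi>_def C_def D_def\<close>)
  qed
  then obtain X :: "nat \<Rightarrow> 'm \<Rightarrow> 'n \<Rightarrow> nat \<Rightarrow> 'a" where
    X: "\<And>N. good (digit_matrix (X N)) (T * N)" "\<And>N. \<phi> N (X N) < ennreal (C N)"
      "\<And>N i j l. l < D * N \<Longrightarrow> X (Suc N) i j l = X N i j l"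
    by blast
  have stable: "X (N + e) i j l = X N i j l" if "l < D * N" for N e i j l
  proof (induction e)
    case (Suc e)
    have "l < D * (N + e)" using that by (simp add: distrib_left)
    then show ?case using Suc X(3) by simp
  qed simp
  \<comment> \<open>Digit \<open>l\<close> is final from stage \<open>Suc l\<close> on, because D
    \<ge> 1.\<close>
  define z where "z = (\<lambda>i j l. X (Suc l) i j l)"
  have zX: "z i j l = X N i j l" if "l < D * N" for N i j l
  proof (cases "Suc l \<le> N")
    case True
    have "1 * Suc l \<le> D * Suc l" using D0 by (intro mult_right_mono) auto
    then have "l < D * Suc l" by simp
    from stable[OF this, of "N - Suc l" i j] True show ?thesis by (simp add: z_def)
  next
    case False
    from stable[OF that, of "Suc l - N" i j] False show ?thesis by (simp add: z_def)
  qed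
  have "digit_matrix z \<in> badly_approx"
  proof (rule badly_approxI[OF T0])
    fix N
    \<comment> \<open>The limit shares its first D N = (m + n)TN digits with \<open>X N\<close>, the
      precision that decides goodness at time T N.\<close>
    show "good (digit_matrix z) (T * N)"
      by (rule good_cong[OF X(1)])
        (metis val_ge_digit_matrix_diff zX D_def mult.assoc)
  qed
  then obtain i where i: "mdist (digit_matrix z) (c i) \<le> \<rho> i" using cover by blast
  have \<rho>i: "0 < \<rho> i" "\<rho> i \<le> 1" using \<rho> by auto
  define L where "L = (LEAST N. (1 / \<beta>) ^ N < \<rho> i)"
  have "\<exists>N. (1 / \<beta>) ^ N < \<rho> i" using \<beta> \<rho>i by (intro real_arch_pow_inv) auto
  then have L: "(1 / \<beta>) ^ L < \<rho> i" unfolding L_def by (rule LeastI_ex)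
  then obtain N where N: "L = Suc N" using \<rho>i by (cases L) auto
  then have LN: "\<rho> i \<le> (1 / \<beta>) ^ N"
    using not_less_Least[of N "\<lambda>N. (1 / \<beta>) ^ N < \<rho> i"] unfolding L_def by simp
  have pw: "(1 / \<beta>) ^ N = real CARD('a) powi (- int (D * N))"
    by (simp add: \<beta>_def power_int_minus power_divide power_mult power_int_mult divide_simps)
  have "c i \<in> node (D * N) z"
    unfolding node_def mem_Collect_eq
  proof (intro allI)
    fix a b
    have "lsabs (digit_matrix z a b - c i a b) \<le> real CARD('a) powi (- int (D * N))"
      using i LN unfolding mdist_le_iff pw by (meson order_trans)
    then show "val_ge (c i a b - digit_matrix z a b) (int (D * N))"
      unfolding lsabs_le_iff by (subst val_ge_minus_commute)
  qed
  then have ci: "c i \<in> node (D * N) (X N)"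
    using node_mono[of "D * N" "D * N" z "X N"] zX by blast
  have "ennreal (C N) \<le> ennreal (\<rho> i powr s)"
    unfolding C_def using L N s \<beta> by (intro ennreal_leI powr_mono2) auto
  also have "\<dots> = (\<Sum>j\<in>{i}. if c j \<in> node (D * N) (X N) then ennreal (\<rho> j powr s) else 0)"
    using ci by simp
  also have "\<dots> \<le> \<phi> N (X N)"
    unfolding \<phi>_def by (rule sum_le_suminf) auto
  finally show False using X(2)[of N] by simp
qed

text \<open>With e = mn - s, taking T \<ge> 1/e gives \<beta>^e = k^{D e} \<ge> 2. This pays for the
  half of the children that may be lost in each step.\<close>

lemma hausdorff_measure_badly_approx_nonzero:
  assumes s: "0 \<le> s" "s < real (CARD('m) * CARD('n))"
  shows "hausdorff_measure mdist s (badly_approx :: ('m::finite \<Rightarrow> 'n::finite \<Rightarrow> 'a::{finite,field} fls) set) \<noteq> 0"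
proof -
  define e where "e = real (CARD('m) * CARD('n)) - s"
  have e: "0 < e" using s by (simp add: e_def)
  define T where "T = CARD('a) ^ (CARD('m + 'n) * 2) + 3 + nat \<lceil>1 / e\<rceil>"
  define D where "D = CARD('m + 'n) * T"
  define \<beta> where "\<beta> = real CARD('a) ^ D"
  have k: "2 \<le> real CARD('a)" using card_field_ge_2[where 'a='a] by simp
  then have \<beta>: "0 < \<beta>" by (simp add: \<beta>_def)
  have "1 / e \<le> real T" unfolding T_def using real_nat_ceiling_ge[of "1 / e"] by linarith
  also have "\<dots> \<le> real D" unfolding D_def by (simp only: of_nat_le_iff) (simp add: Suc_le_eq)
  finally have De: "1 \<le> real D * e" using e by (simp add: field_simps)
  have "2 * \<beta> powr s \<le> \<beta> powr e * \<beta> powr s"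
  proof (rule mult_right_mono)
    have "2 = 2 powr (1::real)" by simp
    also have "\<dots> \<le> 2 powr (real D * e)" using De by (intro powr_mono) auto
    also have "\<dots> \<le> real CARD('a) powr (real D * e)" using k e by (intro powr_mono2) auto
    also have "\<dots> = \<beta> powr e" using k by (simp add: \<beta>_def powr_powr flip: powr_realpow)
    finally show "2 \<le> \<beta> powr e" .
  qed simp
  also have "\<dots> = \<beta> ^ (CARD('m) * CARD('n))"
    using \<beta> by (simp add: e_def powr_realpow flip: powr_add of_nat_mult)
  finally have "ennreal ((1 / \<beta>) powr s) \<le>
      hausdorff_pre mdist s 1 (badly_approx :: ('m \<Rightarrow> 'n \<Rightarrow> 'a fls) set)"
    unfolding \<beta>_def D_def by (intro hausdorff_pre_badly_approx_ge s) (simp_all add: T_def)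
  also have "\<dots> \<le> hausdorff_measure mdist s (badly_approx :: ('m \<Rightarrow> 'n \<Rightarrow> 'a fls) set)"
    unfolding hausdorff_measure_def by (rule SUP_upper) simp
  finally show ?thesis using \<beta> by auto
qed

section \<open>The upper bound\<close>

lemma hausdorff_pre_mono: "E \<subseteq> F \<Longrightarrow> hausdorff_pre d s \<delta> E \<le> hausdorff_pre d s \<delta> F"
  unfolding hausdorff_pre_def by (rule INF_superset_mono) auto

text \<open>The finite covers are enumerated jointly through \<open>prod_decode\<close>. The balls
  of piece \<open>h\<close> and their padding each cost at most \<epsilon> / 2^{h+1}, whence the
  total 2 \<epsilon>.\<close>

lemma hausdorff_pre_finite_covers:
  fixes E :: "nat \<Rightarrow> 'x set" and Z :: "nat \<Rightarrow> 'x set"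
  assumes s: "0 < s" and \<delta>: "0 < \<delta>" and \<epsilon>: "0 < \<epsilon>"
    and fin: "\<And>h. finite (Z h)" and r: "\<And>h. 0 < r h" "\<And>h. r h \<le> \<delta>"
    and cover: "\<And>h. E h \<subseteq> (\<Union>z\<in>Z h. {y. d y z \<le> r h})"
    and size: "\<And>h. real (card (Z h)) * r h powr s \<le> \<epsilon> * (1 / 2) ^ Suc h"
  shows "hausdorff_pre d s \<delta> (\<Union>h. E h) \<le> ennreal (2 * \<epsilon>)"
proof -
  have "\<exists>e. bij_betw e {0..<card (Z h)} (Z h)" for h
    by (rule ex_bij_betw_nat_finite[OF fin])
  then obtain e where e: "\<And>h. bij_betw (e h) {0..<card (Z h)} (Z h)" by metis
  text \<open>All radii in a cover must be positive, so the finite covers are padded with tiny balls.\<close>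
  define \<eta> where "\<eta> = (\<lambda>h l. min \<delta> ((\<epsilon> * (1 / 2) ^ Suc h * (1 / 2) ^ Suc l) powr (1 / s)))"
  have \<eta>: "0 < \<eta> h l" "\<eta> h l \<le> \<delta>" for h l using \<delta> \<epsilon> by (auto simp: \<eta>_def)
  have \<eta>s: "\<eta> h l powr s \<le> \<epsilon> * (1 / 2) ^ Suc h * (1 / 2) ^ Suc l" for h l
  proof -
    have "\<eta> h l powr s \<le> ((\<epsilon> * (1 / 2) ^ Suc h * (1 / 2) ^ Suc l) powr (1 / s)) powr s"
      using s \<eta>(1)[of h l] by (intro powr_mono2) (auto simp: \<eta>_def)
    then show ?thesis using s \<epsilon> by (simp add: powr_powr)
  qed
  define \<rho> where "\<rho> = (\<lambda>(h, l). if l < card (Z h) then r h else \<eta> h l)"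
  define c where "c = (\<lambda>(h, l). e h l)"
  have "hausdorff_pre d s \<delta> (\<Union>h. E h) \<le> (\<Sum>i. ennreal (\<rho> (prod_decode i) powr s))"
    unfolding hausdorff_pre_def
  proof (rule INF_lower2[of "(c \<circ> prod_decode, \<rho> \<circ> prod_decode)"])
    have "\<exists>i. d y (c (prod_decode i)) \<le> \<rho> (prod_decode i)" if "y \<in> E h" for y h
    proof -
      obtain z where "z \<in> Z h" "d y z \<le> r h" using cover[of h] \<open>y \<in> E h\<close> by blast
      then obtain l where l: "l < card (Z h)" "d y (e h l) \<le> r h"
        using e[of h] unfolding bij_betw_def by (metis atLeastLessThan_iff imageE)
      show ?thesis by (rule exI[of _ "prod_encode (h, l)"]) (use l in \<open>simp add: c_def \<rho>_def\<close>)
    qed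
    then show "(c \<circ> prod_decode, \<rho> \<circ> prod_decode) \<in> {(c, \<rho>). (\<forall>i. 0 < \<rho> i \<and> \<rho> i \<le> \<delta>) \<and> (\<Union>h. E h) \<subseteq> (\<Union>i. {y. d y (c i) \<le> \<rho> i})}"
      using r \<eta> by (auto simp: \<rho>_def split: prod.split)
  qed simp
  also have "\<dots> = (\<Sum>h. \<Sum>l. ennreal (\<rho> (h, l) powr s))"
    by (rule suminf_ennreal_2dimen) simp
  also have "\<dots> \<le> (\<Sum>h. ennreal (2 * \<epsilon> * (1 / 2) ^ Suc h))"
  proof (rule suminf_le)
    fix h
    have "(\<Sum>l. ennreal (\<rho> (h, l) powr s)) \<le>
        (\<Sum>l. ennreal ((if l \<in> {..<card (Z h)} then r h powr s else 0) + \<epsilon> * (1 / 2) ^ Suc h * (1 / 2) ^ Suc l))"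
      using \<eta>s[of h] \<epsilon> by (intro suminf_le ennreal_leI) (auto simp: \<rho>_def)
    also have "\<dots> = ennreal ((\<Sum>l\<in>{..<card (Z h)}. r h powr s) + \<epsilon> * (1 / 2) ^ Suc h * 1)"
    proof (rule suminf_ennreal_eq)
      show "(\<lambda>l. (if l \<in> {..<card (Z h)} then r h powr s else 0) + \<epsilon> * (1 / 2) ^ Suc h * (1 / 2) ^ Suc l) sums
          ((\<Sum>l\<in>{..<card (Z h)}. r h powr s) + \<epsilon> * (1 / 2) ^ Suc h * 1)"
        by (intro sums_add sums_mult power_half_series sums_If_finite_set) simp
    qed (use \<epsilon> in auto)
    also have "\<dots> \<le> ennreal (2 * \<epsilon> * (1 / 2) ^ Suc h)"
      using size[of h] by (intro ennreal_leI) simp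
    finally show "(\<Sum>l. ennreal (\<rho> (h, l) powr s)) \<le> ennreal (2 * \<epsilon> * (1 / 2) ^ Suc h)" .
  qed auto
  also have "\<dots> = ennreal (2 * \<epsilon> * 1)"
    by (rule suminf_ennreal_eq[OF _ sums_mult[OF power_half_series]]) (use \<epsilon> in simp)
  finally show ?thesis by simp
qed

text \<open>The whole space is the union of the balls \<open>F h\<close> of radius k^h. Covering one
  by k^{mn(h+N)} balls of radius k^{-N} costs k^{mnh} k^{N(mn-s)}, which tends to 0 as N
  grows.\<close>

lemma hausdorff_measure_above_dimension:
  assumes s: "real (CARD('m) * CARD('n)) < s"
  shows "hausdorff_measure mdist s (E :: ('m::finite \<Rightarrow> 'n::finite \<Rightarrow> 'a::{finite,field} fls) set) = 0"
proof -
  define k where "k = real CARD('a)"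
  define mn where "mn = CARD('m) * CARD('n)"
  have k: "1 < k" using card_field_ge_2[where 'a='a] by (simp add: k_def)
  have "hausdorff_pre mdist s \<delta> E \<le> ennreal (2 * \<epsilon>)" if \<delta>: "0 < \<delta>" and \<epsilon>: "0 < \<epsilon>" for \<delta> \<epsilon> :: real
  proof -
    have "\<exists>N. (1 / k) ^ N \<le> \<delta> \<and> k ^ (mn * (h + N)) * ((1 / k) ^ N) powr s \<le> \<epsilon> * (1 / 2) ^ Suc h" for h
    proof -
      have "(\<lambda>N. (1 / k) ^ N) \<longlonglongrightarrow> 0" using k by (intro LIMSEQ_power_zero) auto
      then have "eventually (\<lambda>N. (1 / k) ^ N < \<delta>) sequentially" using \<delta> by (rule order_tendstoD)
      moreover have "(\<lambda>N. k ^ (mn * h) * (k powr (real mn - s)) ^ N) \<longlonglongrightarrow> k ^ (mn * h) * 0"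
        using k s by (intro tendsto_mult_left LIMSEQ_power_zero) (auto simp: mn_def powr_less_one)
      then have "eventually (\<lambda>N. k ^ (mn * h) * (k powr (real mn - s)) ^ N < \<epsilon> * (1 / 2) ^ Suc h) sequentially"
        using \<epsilon> by (intro order_tendstoD(2)[where y = "k ^ (mn * h) * 0"]) auto
      ultimately have "eventually (\<lambda>N. (1 / k) ^ N < \<delta> \<and> k ^ (mn * h) * (k powr (real mn - s)) ^ N < \<epsilon> * (1 / 2) ^ Suc h) sequentially"
        by (rule eventually_conj)
      then obtain N where N: "(1 / k) ^ N < \<delta>" "k ^ (mn * h) * (k powr (real mn - s)) ^ N < \<epsilon> * (1 / 2) ^ Suc h"
        using eventually_happens'[OF sequentially_bot] by blast
      have "k ^ (mn * (h + N)) * ((1 / k) ^ N) powr s = k ^ (mn * h) * (k powr (real mn - s)) ^ N"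
      proof -
        have "((1 / k) ^ N) powr s = (k powr (- s)) ^ N"
          using k by (simp add: powr_minus_divide powr_divide powr_power power_divide powr_powr mult.commute flip: powr_realpow)
        moreover have "(k powr (real mn - s)) ^ N = k ^ (mn * N) * (k powr (- s)) ^ N"
        proof -
          have "k powr (real mn - s) = k ^ mn * k powr (- s)"
            using k by (simp flip: powr_realpow powr_add)
          then show ?thesis by (simp add: power_mult_distrib power_mult)
        qed
        ultimately show ?thesis by (simp add: power_add distrib_left)
      qed
      then show ?thesis using N by (intro exI[of _ N]) auto
    qed
    then obtain N where N: "\<And>h. (1 / k) ^ N h \<le> \<delta>"
      "\<And>h. k ^ (mn * (h + N h)) * ((1 / k) ^ N h) powr s \<le> \<epsilon> * (1 / 2) ^ Suc h"
      by metis
    \<comment> \<open>The shift by \<open>h\<close> lets the block start at Y^{-h}; its h + N h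
      digits then reach up to the precision k^{-N h}.\<close>
    define ctr :: "nat \<Rightarrow> ('m \<times> 'n \<times> nat \<Rightarrow> 'a) \<Rightarrow> 'm \<Rightarrow> 'n \<Rightarrow> 'a fls" where
      "ctr = (\<lambda>h b i j. fls_shift (int h) (digit_matrix (extend 0 (h + N h) (\<lambda>_ _ _. 0) b) i j))"
    define F where "F = (\<lambda>h. {A :: 'm \<Rightarrow> 'n \<Rightarrow> 'a fls. \<forall>i j. val_ge (A i j) (- int h)})"
    have "hausdorff_pre mdist s \<delta> (\<Union>h. F h) \<le> ennreal (2 * \<epsilon>)"
    proof (rule hausdorff_pre_finite_covers[where Z = "\<lambda>h. ctr h ` blocks (h + N h)" and r = "\<lambda>h. (1 / k) ^ N h"])
      fix h
      have c: "card (ctr h ` blocks (h + N h)) \<le> CARD('a) ^ (mn * (h + N h))"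
        using card_image_le[OF finite_blocks] unfolding card_blocks mn_def .
      have "real (card (ctr h ` blocks (h + N h))) \<le> k ^ (mn * (h + N h))"
        using of_nat_mono[OF c, where 'a=real] by (simp add: k_def)
      then have "real (card (ctr h ` blocks (h + N h))) * ((1 / k) ^ N h) powr s \<le> k ^ (mn * (h + N h)) * ((1 / k) ^ N h) powr s"
        by (intro mult_right_mono) auto
      then show "real (card (ctr h ` blocks (h + N h))) * ((1 / k) ^ N h) powr s \<le> \<epsilon> * (1 / 2) ^ Suc h"
        using N(2)[of h] by linarith
      show "F h \<subseteq> (\<Union>z\<in>ctr h ` blocks (h + N h). {y. mdist y z \<le> (1 / k) ^ N h})"
      proof
        fix A assume A: "A \<in> F h"
        define b where "b = restrict (\<lambda>(i, j, l). fls_nth (A i j) (int l - int h)) (UNIV \<times> UNIV \<times> {..<h + N h})"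
        have "b \<in> blocks (h + N h)" by (simp add: b_def blocks_def)
        moreover have "val_ge (A i j - ctr h b i j) (int (N h))" for i j
          using A by (auto simp: val_ge_def ctr_def extend_def b_def F_def nat_less_iff)
        then have "lsabs (A i j - ctr h b i j) \<le> (1 / k) ^ N h" for i j
          using lsabs_le_iff[of "A i j - ctr h b i j" "int (N h)"]
          by (simp add: k_def power_int_minus power_divide divide_simps)
        then have "mdist A (ctr h b) \<le> (1 / k) ^ N h" by (simp add: mdist_le_iff)
        ultimately show "A \<in> (\<Union>z\<in>ctr h ` blocks (h + N h). {y. mdist y z \<le> (1 / k) ^ N h})" by blast
      qed
    qed (use k \<delta> \<epsilon> s N(1) in \<open>auto intro: le_less_trans[rotated]\<close>)
    moreover have "E \<subseteq> (\<Union>h. F h)"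
    proof
      fix A :: "'m \<Rightarrow> 'n \<Rightarrow> 'a fls"
      define h where "h = nat (\<Sum>(i, j)\<in>UNIV. \<bar>fls_subdegree (A i j)\<bar>)"
      have "val_ge (A i j) (- int h)" for i j
      proof -
        have "\<bar>fls_subdegree (A i j)\<bar> \<le> (\<Sum>(i, j)\<in>UNIV. \<bar>fls_subdegree (A i j)\<bar>)"
          using member_le_sum[of "(i, j)" UNIV "\<lambda>(i, j). \<bar>fls_subdegree (A i j)\<bar>"] by auto
        then have "- int h \<le> fls_subdegree (A i j)" unfolding h_def by linarith
        then show ?thesis by (simp add: val_ge_iff_subdegree)
      qed
      then show "A \<in> (\<Union>h. F h)" by (auto simp: F_def)
    qed
    ultimately show ?thesis using hausdorff_pre_mono order_trans by blast
  qed
  then have le: "hausdorff_pre mdist s \<delta> E \<le> 0 + ennreal \<epsilon>" if "0 < \<delta>" "0 < \<epsilon>" for \<delta> \<epsilon> :: real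
    using that(1) half_gt_zero[OF that(2)] by fastforce
  have "hausdorff_pre mdist s \<delta> E = 0" if "0 < \<delta>" for \<delta>
    using ennreal_le_epsilon[OF le[OF that]] by simp
  then show ?thesis unfolding hausdorff_measure_def by simp
qed

theorem theorem1:
  shows "hausdorff_dim mdist (badly_approx :: ('m::finite \<Rightarrow> 'n::finite \<Rightarrow> 'a::{finite,field} fls) set)
           = ereal (real (CARD('m) * CARD('n)))"
proof (rule antisym)
  let ?B = "badly_approx :: ('m \<Rightarrow> 'n \<Rightarrow> 'a fls) set"
  let ?d = "real (CARD('m) * CARD('n))"
  show "hausdorff_dim mdist ?B \<le> ereal ?d"
  proof (rule ereal_le_epsilon2)
    fix e :: real assume e: "0 < e"
    have "hausdorff_dim mdist ?B \<le> ereal (?d + e)"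
      unfolding hausdorff_dim_def
    proof (rule Inf_lower, rule CollectI, intro exI conjI)
      show "hausdorff_measure mdist (?d + e) ?B = 0"
        using e by (intro hausdorff_measure_above_dimension) simp
    qed (use e in auto)
    then show "hausdorff_dim mdist ?B \<le> ereal ?d + ereal e" by simp
  qed
  show "ereal ?d \<le> hausdorff_dim mdist ?B"
    unfolding hausdorff_dim_def
  proof (rule Inf_greatest, clarify)
    fix s :: real assume "0 \<le> s" "hausdorff_measure mdist s ?B = 0"
    then show "ereal ?d \<le> ereal s"
      using hausdorff_measure_badly_approx_nonzero[of s, where 'm='m and 'n='n and 'a='a] by fastforce
  qed
qed

end
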